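(* Let $G$ be a non-elementary Gromov-hyperbolic group with Cayley graph $\Gamma$ (with respect to a finite symmetric generating set), and consider first passage percolation on $\Gamma$ with i.i.d. edge lengths of law $\rho$, where $\rho$ has no atoms and $\int_0^\infty e^{ax}\,d\rho(x)<\infty$ for some $a>0$. Then there exists $\Omega_0\subset\Omega$ with $\mathbb{P}(\Omega_0)=1$ such that for all $\omega\in\Omega_0$ and for all $\xi\in\partial G$ there exists a semi-infinite $\omega$-geodesic $[1,\xi)_\omega$ starting from $1$ in direction $\xi$.
   Context: $\Gamma$ has edge set $E$ and is equipped with the word metric $d$; $1$ is the identity of $G$ (a vertex of $\Gamma$); $\partial G$ is the Gromov boundary. The configuration space is $\Omega=[0,\infty)^E$ with product measure $\mathbb{P}=\rho^{\otimes E}$. For $\omega\in\Omega$, $d_\omega(x,y)=\inf_{\gamma:x\to y}\sum_{e\in\gamma}\omega(e)$, the infimum being over edge paths $\gamma$ in $\Gamma$ from $x$ to $y$. A finite path is an $\omega$-geodesic if it attains $d_\omega$ between its endpoints; for a.e. $\omega$ there is a unique $\omega$-geodesic $[x,y]_\omega$ between every pair of vertices. A semi-infinite path is an $\omega$-geodesic ray (semi-infinite $\omega$-geodesic) if each of its finite subpaths is an $\omega$-geodesic. A path $\sigma$ accumulates on $\xi\in\partial G$ if there are $v_n\in\sigma$ with $v_n\to\xi$ in the Gromov compactification $\Gamma\cup\partial G$. An $\omega$-geodesic ray has direction $\xi$ if $\xi$ is its only accumulation point in $\partial G$. *)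

theory Defs
  imports "HOL-Algebra.Elementary_Groups" "HOL-Probability.Probability"
begin

section \<open>Cayley graph and word metric\<close>

text \<open>Edges are unoriented, so \<open>s\<close> and its inverse give the same edge, and an involution in \<open>S\<close>
  gives a single edge. If the identity belongs to \<open>S\<close>, the graph has loops \<open>{g}\<close>.\<close>

definition cayley_edges :: "('a, 'b) monoid_scheme \<Rightarrow> 'a set \<Rightarrow> 'a set set" where
  "cayley_edges G S = {{x, x \<otimes>\<^bsub>G\<^esub> s} | x s. x \<in> carrier G \<and> s \<in> S}"

text \<open>A finite edge path is given by its nonempty list of successive vertices.\<close>

definition edge_path :: "('a, 'b) monoid_scheme \<Rightarrow> 'a set \<Rightarrow> 'a \<Rightarrow> 'a \<Rightarrow> 'a list \<Rightarrow> bool" where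
  "edge_path G S x y p \<longleftrightarrow>
     p \<noteq> [] \<and> hd p = x \<and> last p = y \<and> set p \<subseteq> carrier G \<and>
     (\<forall>i. Suc i < length p \<longrightarrow> {p ! i, p ! Suc i} \<in> cayley_edges G S)"

definition word_dist :: "('a, 'b) monoid_scheme \<Rightarrow> 'a set \<Rightarrow> 'a \<Rightarrow> 'a \<Rightarrow> nat" where
  "word_dist G S x y = (LEAST n. \<exists>p. edge_path G S x y p \<and> length p = Suc n)"

section \<open>Hyperbolicity and the Gromov compactification\<close>

definition gromov_product :: "('a, 'b) monoid_scheme \<Rightarrow> 'a set \<Rightarrow> 'a \<Rightarrow> 'a \<Rightarrow> 'a \<Rightarrow> real" where
  "gromov_product G S w x y =
     (real (word_dist G S x w) + real (word_dist G S y w) - real (word_dist G S x y)) / 2"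

definition gromov_hyperbolic :: "('a, 'b) monoid_scheme \<Rightarrow> 'a set \<Rightarrow> bool" where
  "gromov_hyperbolic G S \<longleftrightarrow>
     (\<exists>\<delta>. \<forall>w\<in>carrier G. \<forall>x\<in>carrier G. \<forall>y\<in>carrier G. \<forall>z\<in>carrier G.
        gromov_product G S w x z
          \<ge> min (gromov_product G S w x y) (gromov_product G S w y z) - \<delta>)"

text \<open>Elementary means virtually cyclic; finite groups are included, through the trivial subgroup.\<close>

definition elementary_group :: "('a, 'b) monoid_scheme \<Rightarrow> bool" where
  "elementary_group G \<longleftrightarrow>
     (\<exists>H. subgroup H G \<and> cyclic_group (G\<lparr>carrier := H\<rparr>) \<and> finite (rcosets\<^bsub>G\<^esub> H))"

definition gromov_sequences :: "('a, 'b) monoid_scheme \<Rightarrow> 'a set \<Rightarrow> (nat \<Rightarrow> 'a) set" where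
  "gromov_sequences G S =
     {u. range u \<subseteq> carrier G \<and>
         filterlim (\<lambda>(m, n). gromov_product G S \<one>\<^bsub>G\<^esub> (u m) (u n)) at_top
           (sequentially \<times>\<^sub>F sequentially)}"

definition gromov_rel :: "('a, 'b) monoid_scheme \<Rightarrow> 'a set \<Rightarrow> ((nat \<Rightarrow> 'a) \<times> (nat \<Rightarrow> 'a)) set" where
  "gromov_rel G S =
     {(u, v). u \<in> gromov_sequences G S \<and> v \<in> gromov_sequences G S \<and>
        filterlim (\<lambda>n. gromov_product G S \<one>\<^bsub>G\<^esub> (u n) (v n)) at_top sequentially}"

definition gromov_boundary :: "('a, 'b) monoid_scheme \<Rightarrow> 'a set \<Rightarrow> (nat \<Rightarrow> 'a) set set" where
  "gromov_boundary G S = gromov_sequences G S // gromov_rel G S"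

text \<open>The compactification is taken of the vertex set: its points are \<open>Inl x\<close> for a vertex \<open>x\<close>
  and \<open>Inr \<xi>\<close> for a boundary point \<open>\<xi>\<close>.\<close>

definition gromov_points ::
  "('a, 'b) monoid_scheme \<Rightarrow> 'a set \<Rightarrow> ('a + (nat \<Rightarrow> 'a) set) set" where
  "gromov_points G S = Inl ` carrier G \<union> Inr ` gromov_boundary G S"

fun gromov_reps :: "'a + (nat \<Rightarrow> 'a) set \<Rightarrow> (nat \<Rightarrow> 'a) set" where
  "gromov_reps (Inl x) = {\<lambda>_. x}"
| "gromov_reps (Inr \<xi>) = \<xi>"

text \<open>The Gromov product based at the identity, extended to boundary points as the infimum of the
  lower limits along representing sequences. Subsequences of a representative are again
  representatives, so a single index gives the same infimum as a pair of independent indices.\<close>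

definition ext_gromov_product ::
  "('a, 'b) monoid_scheme \<Rightarrow> 'a set \<Rightarrow>
     'a + (nat \<Rightarrow> 'a) set \<Rightarrow> 'a + (nat \<Rightarrow> 'a) set \<Rightarrow> ereal" where
  "ext_gromov_product G S p q =
     (INF u \<in> gromov_reps p. INF v \<in> gromov_reps q.
        liminf (\<lambda>n. ereal (gromov_product G S \<one>\<^bsub>G\<^esub> (u n) (v n))))"

text \<open>Vertices are isolated, and the sets of points whose product with \<open>\<xi>\<close> exceeds \<open>r\<close>
  generate the neighbourhood filter of \<open>\<xi>\<close>.\<close>

definition gromov_open ::
  "('a, 'b) monoid_scheme \<Rightarrow> 'a set \<Rightarrow> ('a + (nat \<Rightarrow> 'a) set) set \<Rightarrow> bool" where
  "gromov_open G S U \<longleftrightarrow>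
     U \<subseteq> gromov_points G S \<and>
     (\<forall>\<xi>. Inr \<xi> \<in> U \<longrightarrow>
        (\<exists>r::real. {p \<in> gromov_points G S. ext_gromov_product G S p (Inr \<xi>) > ereal r} \<subseteq> U))"

definition gromov_compactification ::
  "('a, 'b) monoid_scheme \<Rightarrow> 'a set \<Rightarrow> ('a + (nat \<Rightarrow> 'a) set) topology" where
  "gromov_compactification G S = topology (gromov_open G S)"

lemma istopology_gromov_open: "istopology (gromov_open G S)"
  unfolding istopology_def
proof (intro conjI allI impI)
  fix U V
  assume U: "gromov_open G S U" and V: "gromov_open G S V"
  show "gromov_open G S (U \<inter> V)"
    unfolding gromov_open_def
  proof (intro conjI allI impI)
    show "U \<inter> V \<subseteq> gromov_points G S"
      using U by (auto simp: gromov_open_def)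
    fix \<xi> assume "Inr \<xi> \<in> U \<inter> V"
    then obtain r s :: real
      where r: "{p \<in> gromov_points G S. ext_gromov_product G S p (Inr \<xi>) > ereal r} \<subseteq> U"
        and s: "{p \<in> gromov_points G S. ext_gromov_product G S p (Inr \<xi>) > ereal s} \<subseteq> V"
      using U V unfolding gromov_open_def by (meson IntD1 IntD2)
    have "{p \<in> gromov_points G S. ext_gromov_product G S p (Inr \<xi>) > ereal (max r s)} \<subseteq> U \<inter> V"
    proof
      fix p assume p: "p \<in> {p \<in> gromov_points G S. ext_gromov_product G S p (Inr \<xi>) > ereal (max r s)}"
      have "ereal r \<le> ereal (max r s)" "ereal s \<le> ereal (max r s)"
        by simp_all
      with p have "ereal r < ext_gromov_product G S p (Inr \<xi>)" "ereal s < ext_gromov_product G S p (Inr \<xi>)"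
        by (metis (no_types, lifting) le_less_trans mem_Collect_eq)+
      with p show "p \<in> U \<inter> V"
        using subsetD[OF r, of p] subsetD[OF s, of p] by simp
    qed
    then show "\<exists>t::real. {p \<in> gromov_points G S. ext_gromov_product G S p (Inr \<xi>) > ereal t} \<subseteq> U \<inter> V"
      by blast
  qed
next
  fix \<K>
  assume K: "\<forall>U\<in>\<K>. gromov_open G S U"
  show "gromov_open G S (\<Union>\<K>)"
    unfolding gromov_open_def
  proof (intro conjI allI impI)
    show "\<Union>\<K> \<subseteq> gromov_points G S"
      using K by (auto simp: gromov_open_def)
    fix \<xi> assume "Inr \<xi> \<in> \<Union>\<K>"
    then obtain U where U: "U \<in> \<K>" "Inr \<xi> \<in> U"
      by auto
    with K have "gromov_open G S U"
      by simp
    with U(2) obtain r :: real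
      where "{p \<in> gromov_points G S. ext_gromov_product G S p (Inr \<xi>) > ereal r} \<subseteq> U"
      by (auto simp: gromov_open_def)
    with U(1) have "{p \<in> gromov_points G S. ext_gromov_product G S p (Inr \<xi>) > ereal r} \<subseteq> \<Union>\<K>"
      by (meson Sup_upper order_trans)
    then show "\<exists>r::real. {p \<in> gromov_points G S. ext_gromov_product G S p (Inr \<xi>) > ereal r} \<subseteq> \<Union>\<K>"
      by (rule exI)
  qed
qed

lemma openin_gromov_compactification:
  "openin (gromov_compactification G S) U \<longleftrightarrow> gromov_open G S U"
  by (simp add: gromov_compactification_def istopology_gromov_open)

lemma topspace_gromov_compactification:
  "topspace (gromov_compactification G S) = gromov_points G S"
proof -
  have "gromov_open G S (gromov_points G S)"
    by (auto simp: gromov_open_def)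
  then show ?thesis
    unfolding topspace_def openin_gromov_compactification
    by (auto simp: gromov_open_def)
qed

section \<open>First passage percolation\<close>

text \<open>Since \<open>\<rho>\<close> lives on the half-line, the underlying space of this measure is the set of all
  nonnegative edge weights (extended by \<^term>\<open>undefined\<close> off the edge set).\<close>

definition fpp_measure ::
  "('a, 'b) monoid_scheme \<Rightarrow> 'a set \<Rightarrow> real measure \<Rightarrow> ('a set \<Rightarrow> real) measure" where
  "fpp_measure G S \<rho> = (\<Pi>\<^sub>M e\<in>cayley_edges G S. \<rho>)"

definition path_weight :: "('a set \<Rightarrow> real) \<Rightarrow> 'a list \<Rightarrow> real" where
  "path_weight \<omega> p = (\<Sum>i<length p - 1. \<omega> {p ! i, p ! Suc i})"

definition fpp_dist ::
  "('a, 'b) monoid_scheme \<Rightarrow> 'a set \<Rightarrow> ('a set \<Rightarrow> real) \<Rightarrow> 'a \<Rightarrow> 'a \<Rightarrow> real" where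
  "fpp_dist G S \<omega> x y = (INF p \<in> {p. edge_path G S x y p}. path_weight \<omega> p)"

definition fpp_geodesic ::
  "('a, 'b) monoid_scheme \<Rightarrow> 'a set \<Rightarrow> ('a set \<Rightarrow> real) \<Rightarrow> 'a list \<Rightarrow> bool" where
  "fpp_geodesic G S \<omega> p \<longleftrightarrow>
     edge_path G S (hd p) (last p) p \<and> path_weight \<omega> p = fpp_dist G S \<omega> (hd p) (last p)"

text \<open>A semi-infinite path is the sequence of its vertices; the finite subpaths below have at least
  one vertex, and their being edge paths makes the whole sequence an edge path.\<close>

definition fpp_geodesic_ray ::
  "('a, 'b) monoid_scheme \<Rightarrow> 'a set \<Rightarrow> ('a set \<Rightarrow> real) \<Rightarrow> (nat \<Rightarrow> 'a) \<Rightarrow> bool" where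
  "fpp_geodesic_ray G S \<omega> \<sigma> \<longleftrightarrow> (\<forall>i j. i \<le> j \<longrightarrow> fpp_geodesic G S \<omega> (map \<sigma> [i..<Suc j]))"

definition accumulates_on ::
  "('a, 'b) monoid_scheme \<Rightarrow> 'a set \<Rightarrow> (nat \<Rightarrow> 'a) \<Rightarrow> (nat \<Rightarrow> 'a) set \<Rightarrow> bool" where
  "accumulates_on G S \<sigma> \<xi> \<longleftrightarrow>
     (\<exists>v. range v \<subseteq> range \<sigma> \<and>
          limitin (gromov_compactification G S) (\<lambda>n. Inl (v n)) (Inr \<xi>) sequentially)"

definition has_direction ::
  "('a, 'b) monoid_scheme \<Rightarrow> 'a set \<Rightarrow> (nat \<Rightarrow> 'a) \<Rightarrow> (nat \<Rightarrow> 'a) set \<Rightarrow> bool" where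
  "has_direction G S \<sigma> \<xi> \<longleftrightarrow> {\<eta> \<in> gromov_boundary G S. accumulates_on G S \<sigma> \<eta>} = {\<xi>}"

end

theory Submission
  imports Defs "HOL-Real_Asymp.Real_Asymp"
begin

text \<open>
  Almost surely every self-avoiding path from \<open>\<one>\<close> with \<open>n\<close> edges, \<open>n\<close> large, has weight between
  \<open>c n\<close> and \<open>C n\<close>: the number of such paths is at most exponential in \<open>n\<close>, so Chernoff bounds and
  Borel--Cantelli apply. Then the \<open>i\<close>-th vertex of an \<open>\<omega>\<close>-geodesic \<open>p\<close> from \<open>\<one>\<close> satisfies
  \<open>i \<le> K |p i| + L\<close> with constants independent of \<open>p\<close>. A path of this kind need not be a quasi-geodesic,
  but it moves away from \<open>\<one>\<close> linearly, whereas concatenating \<open>n\<close> steps costs only \<open>\<delta> log n\<close> in the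
  four-point inequality; so \<open>(p k | p l)\<close> tends to infinity with \<open>k\<close> and \<open>l\<close>, uniformly in \<open>p\<close>.
  If \<open>u n\<close> converges to \<open>\<xi>\<close>, then a pointwise limit of \<open>\<omega>\<close>-geodesics from \<open>\<one>\<close> to \<open>u n\<close> is a ray
  and, by this uniformity, converges to \<open>\<xi>\<close>.
\<close>

section \<open>Edge paths\<close>

lemma edge_path_iff:
  "edge_path G S x y p \<longleftrightarrow>
     p \<noteq> [] \<and> hd p = x \<and> last p = y \<and> set p \<subseteq> carrier G \<and>
     successively (\<lambda>a b. {a, b} \<in> cayley_edges G S) p"
  by (auto simp: edge_path_def successively_conv_nth)

lemma edge_path_Cons_Cons:
  "edge_path G S x z (a # b # p) \<longleftrightarrow>
     a = x \<and> a \<in> carrier G \<and> {a, b} \<in> cayley_edges G S \<and> edge_path G S b z (b # p)"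
  by (auto simp: edge_path_iff)

lemma edge_path_append_tl:
  assumes "edge_path G S x y p" and "edge_path G S y z q"
  shows "edge_path G S x z (p @ tl q)"
proof -
  obtain q' where q: "q = y # q'"
    using assms(2) by (cases q) (auto simp: edge_path_iff)
  show ?thesis
    using assms unfolding q edge_path_iff
    by (auto simp: successively_append_iff successively_Cons)
qed

lemma edge_path_take:
  assumes "edge_path G S x y p" and "i < length p"
  shows "edge_path G S x (p ! i) (take (Suc i) p)"
proof -
  have "last (take (Suc i) p) = p ! i"
    using assms(2) by (simp add: take_Suc_conv_app_nth)
  then show ?thesis
    using assms by (auto simp: edge_path_def dest: in_set_takeD)
qed

lemma edge_path_drop:
  assumes "edge_path G S x y p" and "i < length p"
  shows "edge_path G S (p ! i) y (drop i p)"
  using assms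
  by (auto simp: edge_path_def hd_drop_conv_nth dest: in_set_dropD)

lemma edge_path_rev:
  assumes "edge_path G S x y p"
  shows "edge_path G S y x (rev p)"
  using assms by (auto simp: edge_path_iff hd_rev last_rev insert_commute)

lemma edge_path_last: "edge_path G S x y p \<Longrightarrow> last p = y"
  by (simp add: edge_path_def)

lemma path_weight_simps [simp]:
  "path_weight \<omega> [] = 0" "path_weight \<omega> [x] = 0"
  "path_weight \<omega> (x # y # p) = \<omega> {x, y} + path_weight \<omega> (y # p)"
  by (simp_all add: path_weight_def sum.lessThan_Suc_shift del: sum.lessThan_Suc)

lemma path_weight_append_tl:
  assumes "p \<noteq> []" and "q \<noteq> []" and "last p = hd q"
  shows "path_weight \<omega> (p @ tl q) = path_weight \<omega> p + path_weight \<omega> q"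
  using assms
proof (induction p)
  case (Cons x p)
  then show ?case
    by (cases p; cases q) auto
qed simp

lemma path_weight_split:
  assumes "i < length p"
  shows "path_weight \<omega> p = path_weight \<omega> (take (Suc i) p) + path_weight \<omega> (drop i p)"
proof -
  have "path_weight \<omega> (take (Suc i) p @ tl (drop i p)) =
      path_weight \<omega> (take (Suc i) p) + path_weight \<omega> (drop i p)"
    using assms by (intro path_weight_append_tl) (auto simp: take_Suc_conv_app_nth hd_drop_conv_nth)
  then show ?thesis
    by (simp add: tl_drop drop_Suc [symmetric])
qed

lemma path_weight_nonneg:
  assumes "\<forall>e\<in>cayley_edges G S. 0 \<le> \<omega> e" and "edge_path G S x y p"
  shows "0 \<le> path_weight \<omega> p"
  unfolding path_weight_def using assms by (intro sum_nonneg) (auto simp: edge_path_def)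

text \<open>Loop erasure from the tail: if the new first vertex already occurs in the simple tail,
  everything before that occurrence is cut off, and by nonnegativity this does not raise the
  weight.\<close>

lemma edge_path_distinct:
  assumes "\<forall>e\<in>cayley_edges G S. 0 \<le> \<omega> e" and "edge_path G S x y p"
  shows "\<exists>q. edge_path G S x y q \<and> distinct q \<and> length q \<le> length p
    \<and> path_weight \<omega> q \<le> path_weight \<omega> p"
  using assms(2)
proof (induction p arbitrary: x)
  case Nil
  then show ?case by (simp add: edge_path_def)
next
  case (Cons a p)
  show ?case
  proof (cases p)
    case Nil
    with Cons.prems show ?thesis by (intro exI [of _ "[a]"]) auto
  next
    case (Cons b p')
    have *: "a = x" "a \<in> carrier G" "{a, b} \<in> cayley_edges G S" "edge_path G S b y p"
      using Cons.prems unfolding Cons edge_path_Cons_Cons by auto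
    obtain q where q: "edge_path G S b y q" "distinct q" "length q \<le> length p"
        "path_weight \<omega> q \<le> path_weight \<omega> p"
      using Cons.IH [OF *(4)] by blast
    obtain q' where q': "q = b # q'"
      using q(1) by (cases q) (auto simp: edge_path_def)
    have pos: "0 \<le> \<omega> {a, b}"
      using assms(1) *(3) by blast
    show ?thesis
    proof (cases "a \<in> set q")
      case False
      have "edge_path G S x y (a # q)"
        using * q(1) unfolding q' edge_path_Cons_Cons by auto
      with False q show ?thesis
        by (intro exI [of _ "a # q"]) (auto simp: q' Cons)
    next
      case True
      then obtain i where i: "i < length q" "q ! i = a"
        by (auto simp: in_set_conv_nth)
      have "edge_path G S x y (drop i q)"
        using edge_path_drop [OF q(1) i(1)] i(2) * by simp
      moreover have "path_weight \<omega> (drop i q) \<le> path_weight \<omega> q"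
        using path_weight_split [OF i(1), of \<omega>]
          path_weight_nonneg [OF assms(1) edge_path_take [OF q(1) i(1)]] by simp
      ultimately show ?thesis
        using q pos by (intro exI [of _ "drop i q"]) (auto simp: Cons)
    qed
  qed
qed

text \<open>Equal edges at positions \<open>i\<close> and \<open>j\<close> force
  \<open>i = j\<close>, or else \<open>i = j + 1\<close> and \<open>j = i + 1\<close> at once. So
  the weight of a simple path is a sum over distinct, hence independent, edges.\<close>

lemma inj_on_path_edges:
  assumes "distinct p"
  shows "inj_on (\<lambda>i. {p ! i, p ! Suc i}) {..<length p - 1}"
  using assms by (auto simp: inj_on_def doubleton_eq_iff nth_eq_iff_index_eq)

text \<open>Nonnegative weights bound the set of path weights from below, without which a real
  \<open>INF\<close> says nothing. Geodesics can then be treated by comparison with competing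
  paths.\<close>

lemma fpp_geodesic_iff:
  assumes "\<forall>e\<in>cayley_edges G S. 0 \<le> \<omega> e"
  shows "fpp_geodesic G S \<omega> p \<longleftrightarrow> edge_path G S (hd p) (last p) p \<and>
     (\<forall>q. edge_path G S (hd p) (last p) q \<longrightarrow> path_weight \<omega> p \<le> path_weight \<omega> q)"
proof -
  let ?P = "{q. edge_path G S (hd p) (last p) q}"
  have bdd: "bdd_below (path_weight \<omega> ` ?P)"
    by (rule bdd_belowI [of _ 0]) (auto intro: path_weight_nonneg [OF assms])
  show ?thesis
    unfolding fpp_geodesic_def fpp_dist_def
  proof (intro conj_cong refl iffI allI impI)
    fix q assume "path_weight \<omega> p = (INF q\<in>?P. path_weight \<omega> q)"
      and "edge_path G S (hd p) (last p) q"
    then show "path_weight \<omega> p \<le> path_weight \<omega> q"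
      using bdd by (auto intro: cINF_lower)
  next
    assume "edge_path G S (hd p) (last p) p"
      and "\<forall>q. edge_path G S (hd p) (last p) q \<longrightarrow> path_weight \<omega> p \<le> path_weight \<omega> q"
    then show "path_weight \<omega> p = (INF q\<in>?P. path_weight \<omega> q)"
      using bdd by (intro antisym cINF_greatest cINF_lower) auto
  qed
qed

text \<open>Exchange: a cheaper competitor for one segment, glued to the other segment, would be a
  cheaper path between the ends of \<open>p\<close>.\<close>

lemma
  assumes "\<forall>e\<in>cayley_edges G S. 0 \<le> \<omega> e" and p: "fpp_geodesic G S \<omega> p" and i: "i < length p"
  shows fpp_geodesic_take: "fpp_geodesic G S \<omega> (take (Suc i) p)"
    and fpp_geodesic_drop: "fpp_geodesic G S \<omega> (drop i p)"
proof -
  note iff = fpp_geodesic_iff [OF assms(1)]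
  have path: "edge_path G S (hd p) (last p) p"
    and min: "\<And>q. edge_path G S (hd p) (last p) q \<Longrightarrow> path_weight \<omega> p \<le> path_weight \<omega> q"
    using p iff by auto
  note split = path_weight_split [OF i, of \<omega>]
  note t = edge_path_take [OF path i] and d = edge_path_drop [OF path i]
  have ends: "hd (take (Suc i) p) = hd p" "last (take (Suc i) p) = p ! i"
    "hd (drop i p) = p ! i" "last (drop i p) = last p"
    using t d by (auto simp: edge_path_def)
  have glue: "path_weight \<omega> (q @ tl r) = path_weight \<omega> q + path_weight \<omega> r"
    if "edge_path G S x y q" "edge_path G S y z r" for x y z q r
    using that by (intro path_weight_append_tl) (auto simp: edge_path_def)
  show "fpp_geodesic G S \<omega> (take (Suc i) p)"
    unfolding iff ends
  proof (intro conjI allI impI)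
    fix q assume q: "edge_path G S (hd p) (p ! i) q"
    show "path_weight \<omega> (take (Suc i) p) \<le> path_weight \<omega> q"
      using min [OF edge_path_append_tl [OF q d]] glue [OF q d] split by simp
  qed (rule t)
  show "fpp_geodesic G S \<omega> (drop i p)"
    unfolding iff ends
  proof (intro conjI allI impI)
    fix q assume q: "edge_path G S (p ! i) (last p) q"
    show "path_weight \<omega> (drop i p) \<le> path_weight \<omega> q"
      using min [OF edge_path_append_tl [OF t q]] glue [OF t q] split by simp
  qed (rule d)
qed


section \<open>Word distance\<close>

locale cayley_graph = group G for G :: "('a, 'b) monoid_scheme" (structure) +
  fixes S :: "'a set"
  assumes finite_generators: "finite S"
    and generators_closed: "S \<subseteq> carrier G"
    and generators_inv: "s \<in> S \<Longrightarrow> inv s \<in> S"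
    and generators_generate: "generate G S = carrier G"
begin

abbreviation d :: "'a \<Rightarrow> 'a \<Rightarrow> nat" where "d \<equiv> word_dist G S"

abbreviation gp :: "'a \<Rightarrow> 'a \<Rightarrow> real" where "gp \<equiv> gromov_product G S \<one>"

text \<open>An unoriented edge may be recorded from its other end; in that case the inverse
  generator serves, by the symmetry of \<open>S\<close>.\<close>

lemma edge_imp_generator:
  assumes "{x, y} \<in> cayley_edges G S"
  shows "\<exists>s\<in>S. y = x \<otimes> s"
proof -
  obtain a s where *: "a \<in> carrier G" "s \<in> S" "{x, y} = {a, a \<otimes> s}"
    using assms by (auto simp: cayley_edges_def)
  then consider "x = a" "y = a \<otimes> s" | "y = a" "x = a \<otimes> s"
    by (auto simp: doubleton_eq_iff)
  then show ?thesis
  proof cases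
    case 2
    moreover have "a \<otimes> s \<otimes> inv s = a"
      using * generators_closed by (simp add: m_assoc subset_iff)
    ultimately show ?thesis
      using generators_inv [OF *(2)] by metis
  qed (use * in auto)
qed

lemma edge_path_exists:
  assumes "x \<in> carrier G" and "y \<in> carrier G"
  shows "\<exists>p. edge_path G S x y p"
proof -
  have step: "edge_path G S g (g \<otimes> s) [g, g \<otimes> s]" if "g \<in> carrier G" "s \<in> S" for g s
    using that generators_closed by (auto simp: edge_path_iff cayley_edges_def)
  \<comment> \<open>The starting point \<open>g\<close> stays arbitrary because the path for a
    product \<open>h1 \<otimes> h2\<close> continues from \<open>g \<otimes> h1\<close>.\<close>
  have *: "\<exists>p. edge_path G S g (g \<otimes> h) p" if "h \<in> generate G S" "g \<in> carrier G" for g h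
    using that
  proof (induction arbitrary: g rule: generate.induct)
    case one
    then show ?case by (intro exI [of _ "[g]"]) (simp add: edge_path_def)
  next
    case (incl h)
    then show ?case using step by blast
  next
    case (inv h)
    then show ?case using step generators_inv by blast
  next
    case (eng h1 h2)
    have carr: "h1 \<in> carrier G" "h2 \<in> carrier G"
      using eng.hyps generators_generate by auto
    obtain p where "edge_path G S g (g \<otimes> h1) p"
      using eng by blast
    moreover obtain q where "edge_path G S (g \<otimes> h1) (g \<otimes> h1 \<otimes> h2) q"
      using eng carr by (meson m_closed)
    ultimately show ?case
      using edge_path_append_tl [of G S g "g \<otimes> h1" p "g \<otimes> h1 \<otimes> h2" q] carr eng.prems
      by (auto simp: m_assoc)
  qed
  have "inv x \<otimes> y \<in> generate G S" "x \<otimes> (inv x \<otimes> y) = y"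
    using assms generators_generate by (auto simp: m_assoc [symmetric])
  then show ?thesis
    using * [of "inv x \<otimes> y" x] assms by simp
qed

lemma word_dist_le:
  assumes "edge_path G S x y p"
  shows "d x y \<le> length p - 1"
  unfolding word_dist_def
  using assms by (intro Least_le) (auto simp: edge_path_def)

lemma shortest_path:
  assumes "x \<in> carrier G" and "y \<in> carrier G"
  shows "\<exists>p. edge_path G S x y p \<and> distinct p \<and> length p = Suc (d x y)"
proof -
  obtain p where "edge_path G S x y p"
    using edge_path_exists assms by blast
  moreover from this have "length p = Suc (length p - 1)"
    by (simp add: edge_path_def)
  ultimately have "\<exists>n p. edge_path G S x y p \<and> length p = Suc n"
    by blast
  then have "\<exists>p. edge_path G S x y p \<and> length p = Suc (d x y)"
    unfolding word_dist_def by (rule LeastI_ex)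
  \<comment> \<open>Loop erasure with all weights zero: only its bound on the length matters here,
    and it makes a path of minimal length simple.\<close>
  then obtain q where "edge_path G S x y q" "distinct q" "length q \<le> Suc (d x y)"
    using edge_path_distinct [of G S "\<lambda>_. 0"] by (metis order_refl)
  moreover from this have "length q \<noteq> 0"
    by (simp add: edge_path_def)
  ultimately show ?thesis
    using word_dist_le [of x y q] by (intro exI [of _ q]) linarith
qed

lemma word_dist_refl: "x \<in> carrier G \<Longrightarrow> d x x = 0"
  using word_dist_le [of x x "[x]"] by (simp add: edge_path_def)

lemma word_dist_sym:
  assumes "x \<in> carrier G" and "y \<in> carrier G"
  shows "d x y = d y x"
proof -
  have "d a b \<le> d b a" if a: "a \<in> carrier G" and b: "b \<in> carrier G" for a b
  proof -
    obtain p where "edge_path G S b a p" "length p = Suc (d b a)"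
      using shortest_path [OF b a] by blast
    then show ?thesis
      using word_dist_le [OF edge_path_rev, of b a p] by simp
  qed
  then show ?thesis
    using assms by (meson antisym)
qed

lemma word_dist_triangle:
  assumes "x \<in> carrier G" and "y \<in> carrier G" and "z \<in> carrier G"
  shows "d x z \<le> d x y + d y z"
proof -
  obtain p where p: "edge_path G S x y p" "length p = Suc (d x y)"
    using shortest_path [OF assms(1,2)] by blast
  obtain q where q: "edge_path G S y z q" "length q = Suc (d y z)"
    using shortest_path [OF assms(2,3)] by blast
  show ?thesis
    using word_dist_le [OF edge_path_append_tl [OF p(1) q(1)]] p(2) q(2) by simp
qed

lemma gromov_product_self: "x \<in> carrier G \<Longrightarrow> gp x x = real (d x \<one>)"
  by (simp add: gromov_product_def word_dist_refl)

lemma gromov_product_sym: "x \<in> carrier G \<Longrightarrow> y \<in> carrier G \<Longrightarrow> gp x y = gp y x"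
  by (simp add: gromov_product_def word_dist_sym)

lemma gromov_product_le:
  assumes "x \<in> carrier G" and "y \<in> carrier G"
  shows "gp x y \<le> real (d x \<one>)"
  using word_dist_triangle [of y x \<one>] word_dist_sym [OF assms] assms
  by (simp add: gromov_product_def)

text \<open>Only paths starting at \<open>\<one>\<close> are counted: their weights alone control the geodesics from \<open>\<one>\<close>.\<close>

definition paths_from_one :: "nat \<Rightarrow> 'a list set" where
  "paths_from_one n = {p. \<exists>y. edge_path G S \<one> y p \<and> length p = Suc n}"

lemma paths_from_one_Suc:
  "paths_from_one (Suc n) \<subseteq> (\<lambda>(p, s). p @ [last p \<otimes> s]) ` (paths_from_one n \<times> S)"
proof
  fix q assume "q \<in> paths_from_one (Suc n)"
  then obtain y where y: "edge_path G S \<one> y q" "length q = Suc (Suc n)"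
    by (auto simp: paths_from_one_def)
  define p where "p = butlast q"
  have q: "q = p @ [y]"
    using y by (auto simp: p_def edge_path_def)
  have p: "p \<noteq> []" "length p = Suc n"
    using y(2) unfolding q by auto
  have edge: "{last p, y} \<in> cayley_edges G S" and path: "edge_path G S \<one> (last p) p"
    using y p(1) unfolding q edge_path_iff by (auto simp: successively_append_iff)
  obtain s where "s \<in> S" "y = last p \<otimes> s"
    using edge_imp_generator [OF edge] by blast
  then show "q \<in> (\<lambda>(p, s). p @ [last p \<otimes> s]) ` (paths_from_one n \<times> S)"
    using p path unfolding q by (intro image_eqI [of _ _ "(p, s)"]) (auto simp: paths_from_one_def)
qed

text \<open>Each step has at most \<open>card S\<close> choices. This exponential count is what the
  Chernoff bounds have to beat; the finiteness also makes balls finite.\<close>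

lemma finite_card_paths_from_one:
  "finite (paths_from_one n) \<and> card (paths_from_one n) \<le> card S ^ n"
proof (induction n)
  case 0
  have "paths_from_one 0 \<subseteq> {[\<one>]}"
    by (auto simp: paths_from_one_def edge_path_def length_Suc_conv)
  then show ?case
    using finite_subset [of _ "{[\<one>]}"] card_mono [of "{[\<one>]}"] by simp
next
  case (Suc n)
  have fin: "finite (paths_from_one n \<times> S)"
    using Suc finite_generators by simp
  have "card (paths_from_one (Suc n)) \<le> card (paths_from_one n \<times> S)"
    by (rule surj_card_le [OF fin paths_from_one_Suc])
  also have "\<dots> \<le> card S ^ Suc n"
    using Suc by (simp add: card_cartesian_product mult.commute)
  finally show ?case
    using finite_subset [OF paths_from_one_Suc] fin by blast
qed

lemma finite_ball: "finite {x \<in> carrier G. d \<one> x \<le> n}"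
proof (rule finite_subset)
  show "{x \<in> carrier G. d \<one> x \<le> n} \<subseteq> (\<Union>m\<le>n. last ` paths_from_one m)"
  proof
    fix x assume "x \<in> {x \<in> carrier G. d \<one> x \<le> n}"
    then obtain p where "edge_path G S \<one> x p" "length p = Suc (d \<one> x)" "d \<one> x \<le> n"
      using shortest_path [of \<one> x] by auto
    then show "x \<in> (\<Union>m\<le>n. last ` paths_from_one m)"
      by (intro UN_I [of "d \<one> x"] image_eqI [of _ _ p]) (auto simp: paths_from_one_def edge_path_last)
  qed
qed (use finite_card_paths_from_one in auto)

end

section \<open>Paths of linear growth in a hyperbolic graph\<close>

locale hyperbolic_cayley_graph = cayley_graph +
  fixes \<delta> :: real
  assumes \<delta>_nonneg: "0 \<le> \<delta>"
    and hyperbolic: "\<lbrakk>x \<in> carrier G; y \<in> carrier G; z \<in> carrier G\<rbrakk>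
      \<Longrightarrow> min (gp x y) (gp y z) \<le> gp x z + \<delta>"
begin

lemma hyperbolicD:
  assumes "x \<in> carrier G" "y \<in> carrier G" "z \<in> carrier G" "r \<le> gp x y" "r \<le> gp y z"
  shows "r - \<delta> \<le> gp x z"
  using hyperbolic [OF assms(1-3)] assms(4,5) by linarith

text \<open>Bisecting a path makes the loss logarithmic in its length.\<close>

lemma gromov_product_chain:
  assumes "\<And>i. k \<le> i \<Longrightarrow> i \<le> l \<Longrightarrow> u i \<in> carrier G \<and> r \<le> real (d (u i) \<one>)"
    and "\<And>i. k \<le> i \<Longrightarrow> i < l \<Longrightarrow> r \<le> gp (u i) (u (Suc i))"
    and "k \<le> l" and "l \<le> k + 2 ^ j"
  shows "r - real j * \<delta> \<le> gp (u k) (u l)"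
  using assms
proof (induction j arbitrary: k l)
  case 0
  then consider "l = k" | "l = Suc k"
    by force
  then show ?case
  proof cases
    case 1
    then show ?thesis using 0(1) [of k] gromov_product_self [of "u k"] by simp
  next
    case 2
    then show ?thesis using 0(2) [of k] by simp
  qed
next
  case (Suc j)
  \<comment> \<open>Both halves then have length at most \<open>2 ^ j\<close>. If the path is short,
    \<open>m = l\<close> and the second half is a single vertex, whose product with itself is its
    distance to \<open>\<one>\<close>; hence the assumption on
    \<open>d (u i) \<one>\<close>.\<close>
  define m where "m = min l (k + 2 ^ j)"
  have m: "k \<le> m" "m \<le> l" "m \<le> k + 2 ^ j" "l \<le> m + 2 ^ j"
    using Suc.prems(3,4) by (auto simp: m_def min_def)
  have "r - real j * \<delta> \<le> gp (u k) (u m)"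
    by (rule Suc.IH) (use m Suc.prems in auto)
  moreover have "r - real j * \<delta> \<le> gp (u m) (u l)"
    by (rule Suc.IH) (use m Suc.prems in auto)
  ultimately have "r - real j * \<delta> - \<delta> \<le> gp (u k) (u l)"
    using m Suc.prems(1) by (intro hyperbolicD [of _ "u m"]) auto
  then show ?case
    by (simp add: algebra_simps)
qed

lemma gromov_product_adjacent:
  assumes "d x y \<le> 1" and "r \<le> real (d x \<one>)" and "r \<le> real (d y \<one>)"
  shows "r - 1 / 2 \<le> gp x y"
  using assms by (simp add: gromov_product_def)

text \<open>Along a path of linear growth the products over the dyadic blocks \<open>[2^i, 2^(i+1)]\<close> grow like
  \<open>2^i / K\<close>, faster than the loss \<open>\<delta>\<close> per block incurred by concatenating the blocks.\<close>

lemma gromov_product_linear_growth: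
  assumes "0 < K"
  shows "\<exists>N. \<forall>u m. (\<forall>i\<le>m. u i \<in> carrier G \<and> real i \<le> K * real (d (u i) \<one>) + L) \<longrightarrow>
    (\<forall>i<m. d (u i) (u (Suc i)) \<le> 1) \<longrightarrow>
    (\<forall>k l. N \<le> k \<and> k \<le> m \<and> N \<le> l \<and> l \<le> m \<longrightarrow> R \<le> gp (u k) (u l))"
proof -
  \<comment> \<open>Lower bound for products within block \<open>j\<close>: the distance to
    \<open>\<one>\<close> is at least \<open>(2 ^ j - L) / K\<close>, adjacent vertices lose
    \<open>1 / 2\<close>, and bisecting a block of at most \<open>2 ^ j\<close> steps loses
    \<open>j\<close> times \<open>\<delta>\<close>.\<close>
  define f where "f = (\<lambda>j. (2 ^ j - L) / K - 1 / 2 - real j * \<delta>)"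
  have "filterlim (\<lambda>j. f j - real (Suc j) * \<delta>) at_top sequentially"
    unfolding f_def using assms by real_asymp
  then have "\<forall>\<^sub>F j in sequentially. R + \<delta> \<le> f j - real (Suc j) * \<delta>"
    by (simp add: filterlim_at_top)
  then obtain J where J: "\<And>j. J \<le> j \<Longrightarrow> R + \<delta> + real (Suc j) * \<delta> \<le> f j"
    unfolding eventually_sequentially by force
  show ?thesis
  proof (intro exI [of _ "2 ^ J"] allI impI)
    fix u :: "nat \<Rightarrow> 'a" and m k l
    assume u: "\<forall>i\<le>m. u i \<in> carrier G \<and> real i \<le> K * real (d (u i) \<one>) + L"
      and step: "\<forall>i<m. d (u i) (u (Suc i)) \<le> 1"
      and kl: "2 ^ J \<le> k \<and> k \<le> m \<and> 2 ^ J \<le> l \<and> l \<le> m"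
    have block: "f j \<le> gp (u (2 ^ j)) (u l)" if l: "2 ^ j \<le> l" "l \<le> 2 ^ Suc j" "l \<le> m" for j l
    proof -
      let ?r = "(2 ^ j - L) / K - 1 / 2"
      have far: "(2 ^ j - L) / K \<le> real (d (u i) \<one>)" if "2 ^ j \<le> i" "i \<le> l" for i
      proof -
        have "(2::real) ^ j \<le> real i"
          using that(1) by (metis of_nat_le_iff of_nat_numeral of_nat_power)
        also have "\<dots> \<le> K * real (d (u i) \<one>) + L"
          using u that l by auto
        finally show ?thesis
          using assms by (simp add: divide_le_eq algebra_simps)
      qed
      have "?r - real j * \<delta> \<le> gp (u (2 ^ j)) (u l)"
      proof (rule gromov_product_chain)
        fix i assume i: "2 ^ j \<le> i" "i \<le> l"
        show "u i \<in> carrier G \<and> ?r \<le> real (d (u i) \<one>)"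
          using far [OF i] u i l by auto
      next
        fix i assume i: "2 ^ j \<le> i" "i < l"
        show "?r \<le> gp (u i) (u (Suc i))"
          using far [of i] far [of "Suc i"] step i l by (intro gromov_product_adjacent) auto
      qed (use l in auto)
      then show ?thesis
        by (simp add: f_def)
    qed
    \<comment> \<open>Induction on the number of blocks between \<open>2 ^ j\<close> and
      \<open>l\<close>, going down in \<open>j\<close>: the bound from \<open>2 ^ Suc j\<close>
      holds one more \<open>\<delta>\<close> in reserve, which pays for attaching block
      \<open>j\<close>.\<close>
    have dyadic: "R + \<delta> + real j * \<delta> \<le> gp (u (2 ^ j)) (u l)"
      if "J \<le> j" "2 ^ j \<le> l" "l \<le> 2 ^ (Suc n + j)" "l \<le> m" for j l n
      using that
    proof (induction n arbitrary: j)
      case 0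
      then show ?case
        using block [of j l] J [of j] \<delta>_nonneg by (simp add: algebra_simps)
    next
      case (Suc n)
      show ?case
      proof (cases "l \<le> 2 ^ Suc j")
        case True
        then show ?thesis
          using block [of j l] J [of j] \<delta>_nonneg Suc.prems by (simp add: algebra_simps)
      next
        case False
        have "(2::nat) ^ j \<le> 2 ^ Suc j"
          by simp
        have "R + \<delta> + real (Suc j) * \<delta> \<le> gp (u (2 ^ Suc j)) (u l)"
          using Suc.IH [of "Suc j"] Suc.prems False by simp
        moreover have "R + \<delta> + real (Suc j) * \<delta> \<le> gp (u (2 ^ j)) (u (2 ^ Suc j))"
          using block [of j "2 ^ Suc j"] J [of j] Suc.prems False by simp
        moreover have "2 ^ j \<le> m" "2 ^ Suc j \<le> m"
          using Suc.prems False by auto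
        ultimately have "R + \<delta> + real (Suc j) * \<delta> - \<delta> \<le> gp (u (2 ^ j)) (u l)"
          using u Suc.prems by (intro hyperbolicD [of _ "u (2 ^ Suc j)"]) auto
        then show ?thesis
          by (simp add: algebra_simps)
      qed
    qed
    have base: "R + \<delta> \<le> gp (u (2 ^ J)) (u l)" if "2 ^ J \<le> l" "l \<le> m" for l
    proof -
      have "l \<le> 2 ^ l"
        by (simp add: less_imp_le)
      also have "\<dots> \<le> 2 ^ (Suc l + J)"
        by (intro power_increasing) auto
      finally have "R + \<delta> + real J * \<delta> \<le> gp (u (2 ^ J)) (u l)"
        using dyadic [of J l l] that by simp
      moreover have "0 \<le> real J * \<delta>"
        using \<delta>_nonneg by simp
      ultimately show ?thesis by linarith
    qed
    have carr: "u k \<in> carrier G" "u l \<in> carrier G" "u (2 ^ J) \<in> carrier G"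
      using u kl by auto
    \<comment> \<open>The last \<open>\<delta>\<close> in reserve pays for joining
      \<open>u k\<close> to \<open>u l\<close> through \<open>u (2 ^ J)\<close>.\<close>
    have "R + \<delta> - \<delta> \<le> gp (u k) (u l)"
      using base [of k] base [of l] kl carr gromov_product_sym [of "u k" "u (2 ^ J)"]
      by (intro hyperbolicD [of _ "u (2 ^ J)"]) auto
    then show "R \<le> gp (u k) (u l)" by simp
  qed
qed

end

section \<open>Geodesics when passage times are comparable to lengths\<close>

context cayley_graph
begin

text \<open>This event carries all the randomness: for each \<open>\<omega>\<close> in it, the
  geodesics and rays are obtained deterministically.\<close>

definition linear_passage_times :: "('a set \<Rightarrow> real) \<Rightarrow> bool" where
  "linear_passage_times \<omega> \<longleftrightarrow> (\<forall>e\<in>cayley_edges G S. 0 \<le> \<omega> e) \<and>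
     (\<exists>c>0. \<exists>C N. \<forall>n\<ge>N. \<forall>p\<in>paths_from_one n. distinct p \<longrightarrow>
        c * real n \<le> path_weight \<omega> p \<and> path_weight \<omega> p \<le> C * real n)"

lemma linear_passage_timesE:
  assumes "linear_passage_times \<omega>"
  obtains c C :: real and N :: nat where "0 < c" and
    "\<And>n p y. \<lbrakk>N \<le> n; edge_path G S \<one> y p; distinct p; length p = Suc n\<rbrakk>
      \<Longrightarrow> c * real n \<le> path_weight \<omega> p \<and> path_weight \<omega> p \<le> C * real n"
  using assms unfolding linear_passage_times_def paths_from_one_def by blast

text \<open>A long simple path weighs at least \<open>c * real n\<close>, which exceeds the weight
  of any fixed competitor. So the infimum is a minimum over finitely many short simple
  paths.\<close>

lemma geodesic_exists:
  assumes \<omega>: "linear_passage_times \<omega>" and x: "x \<in> carrier G"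
  shows "\<exists>p. edge_path G S \<one> x p \<and> distinct p \<and> fpp_geodesic G S \<omega> p"
proof -
  have nonneg: "\<forall>e\<in>cayley_edges G S. 0 \<le> \<omega> e"
    using \<omega> by (simp add: linear_passage_times_def)
  obtain c C :: real and N :: nat where c: "0 < c" and lin:
    "\<And>n p y. \<lbrakk>N \<le> n; edge_path G S \<one> y p; distinct p; length p = Suc n\<rbrakk>
      \<Longrightarrow> c * real n \<le> path_weight \<omega> p \<and> path_weight \<omega> p \<le> C * real n"
    using linear_passage_timesE [OF \<omega>] by metis
  obtain p0 where p0: "edge_path G S \<one> x p0" "distinct p0"
    using shortest_path [OF one_closed x] by blast
  obtain M where M: "path_weight \<omega> p0 / c \<le> real M"
    using real_arch_simple by blast
  \<comment> \<open>Beyond \<open>B\<close> the linear lower bound applies (\<open>N\<close>) and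
    exceeds the weight of \<open>p0\<close> (\<open>M\<close>); the third term puts
    \<open>p0\<close> itself into \<open>F\<close>.\<close>
  define B where "B = max (max N M) (length p0)"
  define F where "F = {p. edge_path G S \<one> x p \<and> distinct p \<and> length p \<le> Suc B}"
  have "F \<subseteq> (\<Union>n\<le>B. paths_from_one n)"
  proof
    fix p assume p: "p \<in> F"
    then have "length p = Suc (length p - 1)"
      by (simp add: F_def edge_path_def)
    with p show "p \<in> (\<Union>n\<le>B. paths_from_one n)"
      by (intro UN_I [of "length p - 1"]) (auto simp: F_def paths_from_one_def)
  qed
  then have fin: "finite F"
    by (rule finite_subset) (use finite_card_paths_from_one in auto)
  have p0F: "p0 \<in> F"
    using p0 by (simp add: F_def B_def)
  then obtain p where p: "p \<in> F" "\<And>q. q \<in> F \<Longrightarrow> path_weight \<omega> p \<le> path_weight \<omega> q"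
    using arg_min_if_finite [OF fin, of "path_weight \<omega>"] by (metis empty_iff not_le)
  have "path_weight \<omega> p \<le> path_weight \<omega> r" if r: "edge_path G S \<one> x r" for r
  proof -
    obtain q where q: "edge_path G S \<one> x q" "distinct q" "path_weight \<omega> q \<le> path_weight \<omega> r"
      using edge_path_distinct [OF nonneg r] by blast
    show ?thesis
    proof (cases "length q \<le> Suc B")
      case True
      then have "q \<in> F" using q by (simp add: F_def)
      then show ?thesis using p(2) q(3) by force
    next
      case False
      define n where "n = length q - 1"
      have n: "length q = Suc n" "N \<le> n" "M \<le> n"
        using False by (auto simp: n_def B_def)
      have "path_weight \<omega> p0 \<le> c * real n"
        using M n(3) c by (simp add: divide_le_eq mult.commute)
          (meson mult_left_mono of_nat_le_iff order_trans less_imp_le)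
      also have "\<dots> \<le> path_weight \<omega> q"
        using lin [OF n(2) q(1,2) n(1)] by blast
      finally show ?thesis
        using p(2) [OF p0F] q(3) by linarith
    qed
  qed
  moreover have "edge_path G S \<one> x p" "distinct p" "hd p = \<one>" "last p = x"
    using p(1) by (auto simp: F_def edge_path_def)
  ultimately show ?thesis
    using fpp_geodesic_iff [OF nonneg, of p] by auto
qed

text \<open>The initial segment up to \<open>p ! i\<close> is geodesic and weighs at least
  \<open>c * real i\<close>, but no more than a word-shortest path to the same vertex, whose weight
  is at most linear in its length.\<close>

lemma geodesic_growth:
  assumes \<omega>: "linear_passage_times \<omega>"
  shows "\<exists>K>0. \<exists>L. \<forall>p y i. edge_path G S \<one> y p \<and> distinct p \<and> fpp_geodesic G S \<omega> p \<and> i < length p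
    \<longrightarrow> real i \<le> K * real (d (p ! i) \<one>) + L"
proof -
  have nonneg: "\<forall>e\<in>cayley_edges G S. 0 \<le> \<omega> e"
    using \<omega> by (simp add: linear_passage_times_def)
  obtain c C :: real and N :: nat where c: "0 < c" and lin:
    "\<And>n p y. \<lbrakk>N \<le> n; edge_path G S \<one> y p; distinct p; length p = Suc n\<rbrakk>
      \<Longrightarrow> c * real n \<le> path_weight \<omega> p \<and> path_weight \<omega> p \<le> C * real n"
    using linear_passage_timesE [OF \<omega>] by metis
  obtain q where q: "\<And>x. x \<in> carrier G \<Longrightarrow>
      edge_path G S \<one> x (q x) \<and> distinct (q x) \<and> length (q x) = Suc (d \<one> x)"
    using shortest_path [OF one_closed] by metis
  \<comment> \<open>The linear upper bound starts only at length \<open>N\<close>. The finitely many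
    vertices of this ball are absorbed in an additive constant \<open>M\<close>.\<close>
  define B where "B = {x \<in> carrier G. d \<one> x \<le> N}"
  have "bdd_above ((\<lambda>x. path_weight \<omega> (q x)) ` B)"
    using finite_ball by (simp add: B_def)
  then obtain M where M: "\<And>x. x \<in> B \<Longrightarrow> path_weight \<omega> (q x) \<le> M"
    by (auto simp: bdd_above_def)
  have upper: "path_weight \<omega> (q x) \<le> \<bar>C\<bar> * real (d \<one> x) + \<bar>M\<bar>" if x: "x \<in> carrier G" for x
  proof (cases "d \<one> x \<le> N")
    case True
    then have "path_weight \<omega> (q x) \<le> M" using x M by (simp add: B_def)
    moreover have "0 \<le> \<bar>C\<bar> * real (d \<one> x)" by simp
    ultimately show ?thesis by linarith
  next
    case False
    then have "path_weight \<omega> (q x) \<le> C * real (d \<one> x)"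
      using lin [of "d \<one> x" x "q x"] q [OF x] by simp
    also have "\<dots> \<le> \<bar>C\<bar> * real (d \<one> x)" by (intro mult_right_mono) auto
    finally show ?thesis by linarith
  qed
  \<comment> \<open>The summand \<open>1\<close> keeps the slope positive even if \<open>C\<close>
    is zero, and \<open>real N\<close> covers the indices below \<open>N\<close>.\<close>
  have "real i \<le> (\<bar>C\<bar> / c + 1) * real (d (p ! i) \<one>) + (real N + \<bar>M\<bar> / c)"
    if p: "edge_path G S \<one> y p" "distinct p" "fpp_geodesic G S \<omega> p" "i < length p" for p y i
  proof (cases "N \<le> i")
    case True
    let ?x = "p ! i" and ?t = "take (Suc i) p"
    have x: "?x \<in> carrier G"
      using p by (auto simp: edge_path_def)
    have t: "edge_path G S \<one> ?x ?t"
      by (rule edge_path_take [OF p(1,4)])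
    have "c * real i \<le> path_weight \<omega> ?t"
      using lin [OF True t] p by simp
    also have "\<dots> \<le> path_weight \<omega> (q ?x)"
    proof -
      have "hd ?t = \<one>" "last ?t = ?x"
        using t by (auto simp: edge_path_def)
      then show ?thesis
        using fpp_geodesic_take [OF nonneg p(3,4)] q [OF x]
        unfolding fpp_geodesic_iff [OF nonneg] by metis
    qed
    also have "\<dots> \<le> \<bar>C\<bar> * real (d ?x \<one>) + \<bar>M\<bar>"
      using upper [OF x] word_dist_sym [OF x] by simp
    finally have "real i \<le> (\<bar>C\<bar> * real (d ?x \<one>) + \<bar>M\<bar>) / c"
      using c by (simp add: le_divide_eq mult.commute)
    then show ?thesis
      by (simp add: algebra_simps add_divide_distrib)
  next
    case False
    then have "real i \<le> real N" by simp
    moreover have "0 \<le> (\<bar>C\<bar> / c + 1) * real (d (p ! i) \<one>) + \<bar>M\<bar> / c"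
      using c by simp
    ultimately show ?thesis by linarith
  qed
  moreover have "0 < \<bar>C\<bar> / c + 1"
    using c by (simp add: add_nonneg_pos)
  ultimately show ?thesis by blast
qed

end

section \<open>Geodesic rays towards boundary points\<close>

text \<open>Diagonal compactness: nested infinite index sets, with the \<open>k\<close>-th
  coordinate constant on the \<open>k\<close>-th set. Infinitude allows \<open>n\<close> to be
  chosen large depending on \<open>k\<close>.\<close>

lemma pointwise_limit_of_finite_ranges:
  fixes f :: "nat \<Rightarrow> nat \<Rightarrow> 'c"
  assumes "\<And>k. finite (range (\<lambda>n. f n k))"
  shows "\<exists>\<sigma>. \<forall>k. infinite {n. \<forall>i\<le>k. f n i = \<sigma> i}"
proof -
  have ex: "\<exists>B\<subseteq>A. infinite B \<and> (\<exists>y. \<forall>n\<in>B. f n k = y)" if "infinite A" for A k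
  proof -
    have "finite ((\<lambda>n. f n k) ` A)"
      by (rule finite_subset [OF _ assms [of k]]) auto
    from pigeonhole_infinite [OF that this]
    obtain a where "infinite {n \<in> A. f n k = f a k}" by blast
    then show ?thesis
      by (intro exI [of _ "{n \<in> A. f n k = f a k}"]) auto
  qed
  have "\<exists>A. \<forall>k. (infinite (A k) \<and> (\<exists>y. \<forall>n\<in>A k. f n k = y)) \<and> A (Suc k) \<subseteq> A k"
  proof (rule dependent_nat_choice)
    show "\<exists>A. infinite A \<and> (\<exists>y. \<forall>n\<in>A. f n 0 = y)"
      using ex [of UNIV 0] by auto
  next
    fix A k assume "infinite A \<and> (\<exists>y. \<forall>n\<in>A. f n k = y)"
    then show "\<exists>B. (infinite B \<and> (\<exists>y. \<forall>n\<in>B. f n (Suc k) = y)) \<and> B \<subseteq> A"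
      using ex [of A "Suc k"] by auto
  qed
  then obtain A where A: "\<And>k. infinite (A k)" "\<And>k. \<exists>y. \<forall>n\<in>A k. f n k = y" "\<And>k. A (Suc k) \<subseteq> A k"
    by blast
  then obtain \<sigma> where \<sigma>: "\<And>k n. n \<in> A k \<Longrightarrow> f n k = \<sigma> k"
    by metis
  have "A k \<subseteq> A i" if "i \<le> k" for i k
    using that A(3) by (rule lift_Suc_antimono_le [of A, rotated])
  then have "A k \<subseteq> {n. \<forall>i\<le>k. f n i = \<sigma> i}" for k
    using \<sigma> by blast
  then show ?thesis
    using A(1) by (meson finite_subset)
qed

section \<open>Gromov sequences and representatives of boundary points\<close>

context cayley_graph
begin

lemma gromov_sequences_iff:
  "u \<in> gromov_sequences G S \<longleftrightarrow>
     range u \<subseteq> carrier G \<and> (\<forall>R. \<exists>N. \<forall>m\<ge>N. \<forall>n\<ge>N. R \<le> gp (u m) (u n))"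
  unfolding gromov_sequences_def filterlim_at_top eventually_prod_sequentially
  by (simp, meson)

lemma gromov_rel_iff:
  "(u, v) \<in> gromov_rel G S \<longleftrightarrow> u \<in> gromov_sequences G S \<and> v \<in> gromov_sequences G S \<and>
     (\<forall>R. \<exists>N. \<forall>n\<ge>N. R \<le> gp (u n) (v n))"
  unfolding gromov_rel_def filterlim_at_top eventually_sequentially by auto

end

context hyperbolic_cayley_graph
begin

text \<open>Transitivity is the four-point inequality, with a loss of one \<open>\<delta>\<close>;
  reflexivity is the diagonal of the Gromov condition. Any member of a boundary point may then
  represent it.\<close>

lemma equiv_gromov_rel: "equiv (gromov_sequences G S) (gromov_rel G S)"
proof (rule equivI)
  show "gromov_rel G S \<subseteq> gromov_sequences G S \<times> gromov_sequences G S"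
    by (auto simp: gromov_rel_iff)
  show "refl_on (gromov_sequences G S) (gromov_rel G S)"
  proof (rule refl_onI)
    fix u assume u: "u \<in> gromov_sequences G S"
    have "\<exists>N. \<forall>n\<ge>N. R \<le> gp (u n) (u n)" for R
    proof -
      obtain N where "\<forall>m\<ge>N. \<forall>n\<ge>N. R \<le> gp (u m) (u n)"
        using u unfolding gromov_sequences_iff by blast
      then show ?thesis by (intro exI [of _ N]) simp
    qed
    with u show "(u, u) \<in> gromov_rel G S"
      unfolding gromov_rel_iff by simp
  qed
  show "sym (gromov_rel G S)"
  proof (rule symI)
    fix u v assume uv: "(u, v) \<in> gromov_rel G S"
    then have "u n \<in> carrier G" "v n \<in> carrier G" for n
      by (auto simp: gromov_rel_iff gromov_sequences_iff)
    then have "gp (u n) (v n) = gp (v n) (u n)" for n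
      by (rule gromov_product_sym)
    with uv show "(v, u) \<in> gromov_rel G S"
      unfolding gromov_rel_iff by simp
  qed
  show "trans (gromov_rel G S)"
  proof (rule transI)
    fix u v w assume uv: "(u, v) \<in> gromov_rel G S" and vw: "(v, w) \<in> gromov_rel G S"
    have "\<exists>N. \<forall>n\<ge>N. R \<le> gp (u n) (w n)" for R
    proof -
      obtain N1 where N1: "\<forall>n\<ge>N1. R + \<delta> \<le> gp (u n) (v n)"
        using uv unfolding gromov_rel_iff by blast
      obtain N2 where N2: "\<forall>n\<ge>N2. R + \<delta> \<le> gp (v n) (w n)"
        using vw unfolding gromov_rel_iff by blast
      have carr: "u n \<in> carrier G" "v n \<in> carrier G" "w n \<in> carrier G" for n
        using uv vw by (auto simp: gromov_rel_iff gromov_sequences_iff)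
      have "R + \<delta> - \<delta> \<le> gp (u n) (w n)" if "n \<ge> max N1 N2" for n
        using that N1 N2 carr by (intro hyperbolicD [of _ "v n"]) auto
      then show ?thesis
        by (intro exI [of _ "max N1 N2"]) auto
    qed
    then show "(u, w) \<in> gromov_rel G S"
      using uv vw unfolding gromov_rel_iff by blast
  qed
qed

lemma gromov_boundaryE:
  assumes "\<xi> \<in> gromov_boundary G S"
  obtains u where "u \<in> gromov_sequences G S" "\<xi> = gromov_rel G S `` {u}" "u \<in> \<xi>"
proof -
  obtain u where u: "u \<in> gromov_sequences G S" "\<xi> = gromov_rel G S `` {u}"
    using assms unfolding gromov_boundary_def by (rule quotientE)
  moreover from u have "u \<in> \<xi>"
    using equiv_class_self [OF equiv_gromov_rel] by simp
  ultimately show thesis by (rule that)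
qed

lemma ext_gromov_product_gt:
  assumes "r < ext_gromov_product G S p q" and "u \<in> gromov_reps p" and "v \<in> gromov_reps q"
  shows "\<forall>\<^sub>F n in sequentially. r < ereal (gp (u n) (v n))"
proof -
  have "r < (INF v \<in> gromov_reps q. liminf (\<lambda>n. ereal (gp (u n) (v n))))"
    using assms(1,2) unfolding ext_gromov_product_def by (rule less_INF_D)
  then have "r < liminf (\<lambda>n. ereal (gp (u n) (v n)))"
    using assms(3) by (rule less_INF_D)
  then show ?thesis by (rule less_LiminfD)
qed

text \<open>Control along the single representative \<open>u\<close> suffices, since hyperbolicity
  transfers it to every other representative of \<open>\<xi>\<close> with a loss of
  \<open>\<delta>\<close>.\<close>

lemma has_directionI:
  assumes \<sigma>: "range \<sigma> \<subseteq> carrier G" and \<xi>: "\<xi> \<in> gromov_boundary G S" and u: "u \<in> \<xi>"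
    and lim: "\<And>R. \<exists>N. \<forall>k\<ge>N. \<forall>l\<ge>N. R \<le> gp (\<sigma> k) (u l)"
  shows "has_direction G S \<sigma> \<xi>"
proof -
  let ?P = "gromov_points G S"
  obtain x where "\<xi> = gromov_rel G S `` {x}"
    using gromov_boundaryE [OF \<xi>] by metis
  with u have \<xi>_eq: "\<xi> = gromov_rel G S `` {u}"
    using equiv_class_eq [OF equiv_gromov_rel, of x u] by simp
  then have rel: "(u, v) \<in> gromov_rel G S" if "v \<in> \<xi>" for v
    using that by simp
  have u_seq: "u \<in> gromov_sequences G S"
    using rel [OF u] by (simp add: gromov_rel_iff)
  then have u_carr: "u n \<in> carrier G" for n
    by (auto simp: gromov_sequences_iff)
  have \<sigma>_carr: "\<sigma> n \<in> carrier G" for n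
    using \<sigma> by auto
  have conv: "limitin (gromov_compactification G S) (\<lambda>n. Inl (\<sigma> n)) (Inr \<xi>) sequentially"
    unfolding limitin_def topspace_gromov_compactification openin_gromov_compactification
  proof (intro conjI allI impI)
    show "Inr \<xi> \<in> ?P"
      using \<xi> by (simp add: gromov_points_def)
    fix U assume "gromov_open G S U \<and> Inr \<xi> \<in> U"
    then obtain r :: real where r: "{p \<in> ?P. ereal r < ext_gromov_product G S p (Inr \<xi>)} \<subseteq> U"
      unfolding gromov_open_def by blast
    \<comment> \<open>The \<open>\<delta>\<close> is spent in passing from \<open>u\<close> to
      another representative; the \<open>1\<close> restores strictness, as the lower limit preserves
      only weak inequalities.\<close>
    obtain N where N: "\<forall>k\<ge>N. \<forall>l\<ge>N. r + 1 + \<delta> \<le> gp (\<sigma> k) (u l)"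
      using lim by blast
    have "Inl (\<sigma> k) \<in> U" if "k \<ge> N" for k
    proof -
      have "ereal (r + 1) \<le> ext_gromov_product G S (Inl (\<sigma> k)) (Inr \<xi>)"
        unfolding ext_gromov_product_def gromov_reps.simps
      proof (intro INF_greatest)
        fix w v :: "nat \<Rightarrow> 'a" assume w: "w \<in> {\<lambda>_. \<sigma> k}" and v: "v \<in> \<xi>"
        obtain M where M: "\<forall>n\<ge>M. r + 1 + \<delta> \<le> gp (u n) (v n)"
          using rel [OF v] unfolding gromov_rel_iff by blast
        have v_carr: "v n \<in> carrier G" for n
          using rel [OF v] by (auto simp: gromov_rel_iff gromov_sequences_iff)
        have "r + 1 + \<delta> - \<delta> \<le> gp (\<sigma> k) (v n)" if "n \<ge> max M N" for n
          using that N M \<open>k \<ge> N\<close> \<sigma>_carr u_carr v_carr by (intro hyperbolicD [of _ "u n"]) auto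
        then have "\<forall>\<^sub>F n in sequentially. ereal (r + 1) \<le> ereal (gp (w n) (v n))"
          using w unfolding eventually_sequentially by (intro exI [of _ "max M N"]) auto
        then show "ereal (r + 1) \<le> liminf (\<lambda>n. ereal (gp (w n) (v n)))"
          by (rule Liminf_bounded)
      qed
      moreover have "ereal r < ereal (r + 1)" by simp
      ultimately have "ereal r < ext_gromov_product G S (Inl (\<sigma> k)) (Inr \<xi>)"
        by (rule order.strict_trans2 [rotated])
      then show ?thesis
        using r \<sigma>_carr by (auto simp: gromov_points_def)
    qed
    then show "\<forall>\<^sub>F n in sequentially. Inl (\<sigma> n) \<in> U"
      unfolding eventually_sequentially by blast
  qed
  \<comment> \<open>The ray together with \<open>\<xi>\<close> is closed, so no other boundary point is an accumulation point.\<close>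
  define U where "U = ?P - insert (Inr \<xi>) (Inl ` range \<sigma>)"
  have "gromov_open G S U"
    unfolding gromov_open_def
  proof (intro conjI allI impI)
    show "U \<subseteq> ?P" by (auto simp: U_def)
    fix \<zeta> assume "Inr \<zeta> \<in> U"
    then have \<zeta>: "\<zeta> \<in> gromov_boundary G S" "\<zeta> \<noteq> \<xi>"
      by (auto simp: U_def gromov_points_def)
    obtain w where w: "w \<in> gromov_sequences G S" "\<zeta> = gromov_rel G S `` {w}" "w \<in> \<zeta>"
      using \<zeta>(1) by (rule gromov_boundaryE)
    have w_carr: "w n \<in> carrier G" for n
      using w(1) by (auto simp: gromov_sequences_iff)
    have "(u, w) \<notin> gromov_rel G S"
    proof
      assume "(u, w) \<in> gromov_rel G S"
      then have "\<xi> = \<zeta>"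
        unfolding \<xi>_eq w(2) by (rule equiv_class_eq [OF equiv_gromov_rel])
      with \<zeta>(2) show False by simp
    qed
    \<comment> \<open>Distinct boundary points: the products of \<open>u\<close> and
      \<open>w\<close> drop below \<open>R\<close> infinitely often.\<close>
    then obtain R where R: "\<And>N. \<exists>n\<ge>N. gp (u n) (w n) < R"
      unfolding gromov_rel_iff using u_seq w(1) by (meson not_le)
    obtain N where N: "\<forall>k\<ge>N. \<forall>l\<ge>N. R + \<delta> \<le> gp (\<sigma> k) (u l)"
      using lim by blast
    \<comment> \<open>Early vertices \<open>\<sigma> k\<close> have products at most
      \<open>B\<close>. For later ones, and for \<open>\<xi>\<close>, a product with
      \<open>\<zeta>\<close> above \<open>R + \<delta>\<close> would keep
      \<open>gp (u n) (w n)\<close> at least \<open>R\<close> for all large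
      \<open>n\<close>.\<close>
    define B where "B = Max ((\<lambda>k. real (d (\<sigma> k) \<one>)) ` {..N})"
    define r where "r = max (R + \<delta>) B"
    have "\<not> ereal r < ext_gromov_product G S (Inl (\<sigma> k)) (Inr \<zeta>)" for k
    proof
      assume "ereal r < ext_gromov_product G S (Inl (\<sigma> k)) (Inr \<zeta>)"
      then have "\<forall>\<^sub>F n in sequentially. ereal r < ereal (gp (\<sigma> k) (w n))"
        by (rule ext_gromov_product_gt) (use w in auto)
      then obtain M where M: "\<And>n. n \<ge> M \<Longrightarrow> r < gp (\<sigma> k) (w n)"
        unfolding eventually_sequentially by auto
      have "k \<ge> N"
      proof (rule ccontr)
        assume "\<not> k \<ge> N"
        then have "real (d (\<sigma> k) \<one>) \<le> B"
          unfolding B_def by (intro Max_ge) auto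
        then show False
          using M [of M] gromov_product_le [of "\<sigma> k" "w M"] \<sigma>_carr w_carr by (simp add: r_def)
      qed
      obtain n where n: "n \<ge> max M N" "gp (u n) (w n) < R"
        using R by blast
      have "R + \<delta> \<le> gp (u n) (\<sigma> k)"
        using N \<open>k \<ge> N\<close> n(1) gromov_product_sym [OF u_carr \<sigma>_carr] by simp
      moreover have "R + \<delta> \<le> gp (\<sigma> k) (w n)"
        using M [of n] n(1) by (simp add: r_def)
      ultimately have "R + \<delta> - \<delta> \<le> gp (u n) (w n)"
        using u_carr \<sigma>_carr w_carr by (intro hyperbolicD [of _ "\<sigma> k"]) auto
      with n(2) show False by simp
    qed
    moreover have "\<not> ereal r < ext_gromov_product G S (Inr \<xi>) (Inr \<zeta>)"
    proof
      assume "ereal r < ext_gromov_product G S (Inr \<xi>) (Inr \<zeta>)"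
      then have "\<forall>\<^sub>F n in sequentially. ereal r < ereal (gp (u n) (w n))"
        by (rule ext_gromov_product_gt) (use w u in auto)
      then obtain M where M: "\<And>n. n \<ge> M \<Longrightarrow> r < gp (u n) (w n)"
        unfolding eventually_sequentially by auto
      obtain n where "n \<ge> M" "gp (u n) (w n) < R"
        using R by blast
      then show False
        using M [of n] \<delta>_nonneg by (simp add: r_def)
    qed
    ultimately show "\<exists>r::real. {p \<in> ?P. ereal r < ext_gromov_product G S p (Inr \<zeta>)} \<subseteq> U"
      by (intro exI [of _ r]) (auto simp: U_def)
  qed
  have "\<eta> = \<xi>" if \<eta>: "\<eta> \<in> gromov_boundary G S" "accumulates_on G S \<sigma> \<eta>" for \<eta>
  proof (rule ccontr)
    assume "\<eta> \<noteq> \<xi>"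
    then have "Inr \<eta> \<in> U"
      using \<eta> by (auto simp: U_def gromov_points_def)
    moreover obtain v where v: "range v \<subseteq> range \<sigma>"
        "limitin (gromov_compactification G S) (\<lambda>n. Inl (v n)) (Inr \<eta>) sequentially"
      using \<eta>(2) by (auto simp: accumulates_on_def)
    ultimately have "\<forall>\<^sub>F n in sequentially. Inl (v n) \<in> U"
      using \<open>gromov_open G S U\<close> unfolding limitin_def openin_gromov_compactification by blast
    then obtain n where "Inl (v n) \<in> U"
      unfolding eventually_sequentially by blast
    with v(1) show False
      by (auto simp: U_def)
  qed
  moreover have "accumulates_on G S \<sigma> \<xi>"
    using conv unfolding accumulates_on_def by blast
  ultimately show ?thesis
    using \<xi> unfolding has_direction_def by blast
qed

section \<open>Construction of the ray as a limit of finite geodesics\<close>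

lemma geodesic_ray_exists:
  assumes \<omega>: "linear_passage_times \<omega>" and \<xi>: "\<xi> \<in> gromov_boundary G S"
  shows "\<exists>\<sigma>. \<sigma> 0 = \<one> \<and> fpp_geodesic_ray G S \<omega> \<sigma> \<and> has_direction G S \<sigma> \<xi>"
proof -
  have nonneg: "\<forall>e\<in>cayley_edges G S. 0 \<le> \<omega> e"
    using \<omega> by (simp add: linear_passage_times_def)
  obtain u where u: "u \<in> gromov_sequences G S" "u \<in> \<xi>"
    using gromov_boundaryE [OF \<xi>] by metis
  have u_carr: "u n \<in> carrier G" for n
    using u(1) by (auto simp: gromov_sequences_iff)
  have "\<forall>n. \<exists>p. edge_path G S \<one> (u n) p \<and> distinct p \<and> fpp_geodesic G S \<omega> p"
    using geodesic_exists [OF \<omega>] u_carr by blast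
  then obtain \<gamma> where \<gamma>: "\<And>n. edge_path G S \<one> (u n) (\<gamma> n)" "\<And>n. distinct (\<gamma> n)"
      "\<And>n. fpp_geodesic G S \<omega> (\<gamma> n)"
    by metis
  define m where "m n = length (\<gamma> n) - 1" for n
  have len: "length (\<gamma> n) = Suc (m n)" for n
    using \<gamma>(1) [of n] by (simp add: m_def edge_path_def)
  have \<gamma>_0: "\<gamma> n ! 0 = \<one>" and \<gamma>_end: "\<gamma> n ! m n = u n" for n
    using \<gamma>(1) [of n] by (auto simp: m_def edge_path_def hd_conv_nth last_conv_nth)
  have \<gamma>_carr: "\<gamma> n ! i \<in> carrier G" if "i \<le> m n" for n i
    using \<gamma>(1) [of n] that len [of n] by (auto simp: edge_path_def)
  have m_ge: "d \<one> (\<gamma> n ! i) \<le> i" if "i \<le> m n" for n i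
    using word_dist_le [OF edge_path_take [OF \<gamma>(1), of i n]] that len [of n] by simp
  have \<gamma>_step: "d (\<gamma> n ! i) (\<gamma> n ! Suc i) \<le> 1" if "i < m n" for n i
    using word_dist_le [of "\<gamma> n ! i" "\<gamma> n ! Suc i" "[\<gamma> n ! i, \<gamma> n ! Suc i]"]
      \<gamma>(1) [of n] \<gamma>_carr [of i n] \<gamma>_carr [of "Suc i" n] that len [of n] by (auto simp: edge_path_def)

  \<comment> \<open>Each geodesic is frozen at its endpoint so that every coordinate exists; the
    \<open>k\<close>-th coordinate stays in the finite ball of radius \<open>k\<close>.\<close>
  define f where "f n k = \<gamma> n ! min k (m n)" for n k
  have "finite (range (\<lambda>n. f n k))" for k
  proof (rule finite_subset [OF _ finite_ball [of k]])
    show "range (\<lambda>n. f n k) \<subseteq> {x \<in> carrier G. d \<one> x \<le> k}"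
      unfolding f_def by (auto intro!: \<gamma>_carr order_trans [OF m_ge])
  qed
  then obtain \<sigma> where \<sigma>: "\<And>k. infinite {n. \<forall>i\<le>k. f n i = \<sigma> i}"
    using pointwise_limit_of_finite_ranges [of f] by blast
  \<comment> \<open>The points \<open>u n\<close> leave every ball, so for large \<open>n\<close>
    the freezing does not affect the first \<open>k\<close> steps.\<close>
  have agree: "\<exists>n\<ge>N. k \<le> m n \<and> (\<forall>i\<le>k. \<gamma> n ! i = \<sigma> i)" for k N
  proof -
    obtain M where M: "\<forall>a\<ge>M. \<forall>b\<ge>M. real k \<le> gp (u a) (u b)"
      using u(1) unfolding gromov_sequences_iff by blast
    obtain n where n: "n \<ge> max M N" "\<forall>i\<le>k. f n i = \<sigma> i"
      using \<sigma> [of k] unfolding infinite_nat_iff_unbounded_le by blast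
    have "real k \<le> real (d (u n) \<one>)"
      using M n(1) gromov_product_self [OF u_carr] by (metis max.boundedE)
    then have "k \<le> m n"
      using m_ge [of "m n" n] \<gamma>_end [of n] word_dist_sym [OF one_closed u_carr] by simp
    with n show ?thesis
      by (intro exI [of _ n]) (auto simp: f_def min_def)
  qed
  have \<sigma>_0: "\<sigma> 0 = \<one>"
    using agree [of 0 0] \<gamma>_0 by auto
  have \<sigma>_carr: "\<sigma> k \<in> carrier G" for k
    using agree [of 0 k] \<gamma>_carr by (metis order_refl)
  have ray: "fpp_geodesic_ray G S \<omega> \<sigma>"
    unfolding fpp_geodesic_ray_def
  proof (intro allI impI)
    fix i j :: nat assume ij: "i \<le> j"
    obtain n where n: "j \<le> m n" "\<forall>i\<le>j. \<gamma> n ! i = \<sigma> i"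
      using agree [of 0 j] by blast
    have "map \<sigma> [i..<Suc j] = drop i (take (Suc j) (\<gamma> n))"
      using n ij len [of n] by (intro nth_equalityI) (auto simp del: upt_Suc)
    moreover have "fpp_geodesic G S \<omega> (drop i (take (Suc j) (\<gamma> n)))"
      using n ij len [of n]
      by (intro fpp_geodesic_drop [OF nonneg] fpp_geodesic_take [OF nonneg \<gamma>(3)]) auto
    ultimately show "fpp_geodesic G S \<omega> (map \<sigma> [i..<Suc j])"
      by simp
  qed
  obtain K L where K: "0 < K" and growth:
    "\<forall>p y i. edge_path G S \<one> y p \<and> distinct p \<and> fpp_geodesic G S \<omega> p \<and> i < length p
      \<longrightarrow> real i \<le> K * real (d (p ! i) \<one>) + L"
    using geodesic_growth [OF \<omega>] by blast
  have \<gamma>_growth: "real i \<le> K * real (d (\<gamma> n ! i) \<one>) + L" if "i \<le> m n" for n i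
    using growth \<gamma> [of n] that len [of n] by auto
  have "\<exists>N. \<forall>k\<ge>N. \<forall>l\<ge>N. R \<le> gp (\<sigma> k) (u l)" for R
  proof -
    obtain N where N: "\<forall>v m. (\<forall>i\<le>m. v i \<in> carrier G \<and> real i \<le> K * real (d (v i) \<one>) + L) \<longrightarrow>
        (\<forall>i<m. d (v i) (v (Suc i)) \<le> 1) \<longrightarrow>
        (\<forall>k l. N \<le> k \<and> k \<le> m \<and> N \<le> l \<and> l \<le> m \<longrightarrow> R + \<delta> \<le> gp (v k) (v l))"
      using gromov_product_linear_growth [OF K, of L "R + \<delta>"] by (rule exE)
    \<comment> \<open>The threshold \<open>N\<close> is the same for all geodesics. This is
      essential, since the \<open>n\<close> whose geodesic agrees with \<open>\<sigma>\<close> up to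
      \<open>k\<close> varies with \<open>k\<close>.\<close>
    have unif: "R + \<delta> \<le> gp (\<gamma> n ! k) (u n)" if "N \<le> k" "k \<le> m n" for n k
    proof -
      have "R + \<delta> \<le> gp (\<gamma> n ! k) (\<gamma> n ! m n)"
        using \<gamma>_carr \<gamma>_step \<gamma>_growth that by (intro N [rule_format, of "m n" "(!) (\<gamma> n)"]) auto
      then show ?thesis by (simp add: \<gamma>_end)
    qed
    obtain M where M: "\<forall>a\<ge>M. \<forall>b\<ge>M. R + \<delta> \<le> gp (u a) (u b)"
      using u(1) unfolding gromov_sequences_iff by blast
    have "R \<le> gp (\<sigma> k) (u l)" if kl: "k \<ge> max M N" "l \<ge> max M N" for k l
    proof -
      obtain n where n: "n \<ge> M" "k \<le> m n" "\<gamma> n ! k = \<sigma> k"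
        using agree [of M k] by blast
      have "R + \<delta> - \<delta> \<le> gp (\<sigma> k) (u l)"
        using unif [of k n] n M kl \<sigma>_carr u_carr by (intro hyperbolicD [of _ "u n"]) auto
      then show ?thesis by simp
    qed
    then show ?thesis by blast
  qed
  then have "has_direction G S \<sigma> \<xi>"
    using \<sigma>_carr by (intro has_directionI [OF _ \<xi> u(2)]) auto
  with \<sigma>_0 ray show ?thesis by blast
qed

end

section \<open>Passage times are comparable to lengths\<close>

context cayley_graph
begin

definition path_edges :: "'a list \<Rightarrow> 'a set set" where
  "path_edges p = (\<lambda>i. {p ! i, p ! Suc i}) ` {..<length p - 1}"

lemma path_weight_eq_sum:
  assumes "distinct p"
  shows "path_weight \<omega> p = (\<Sum>e\<in>path_edges p. \<omega> e)"
  using sum.reindex [OF inj_on_path_edges [OF assms], of \<omega>]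
  by (simp add: path_weight_def path_edges_def comp_def)

lemma card_path_edges: "distinct p \<Longrightarrow> card (path_edges p) = length p - 1"
  using card_image [OF inj_on_path_edges, of p] by (simp add: path_edges_def)

lemma path_edges_subset: "edge_path G S x y p \<Longrightarrow> path_edges p \<subseteq> cayley_edges G S"
  by (auto simp: path_edges_def edge_path_def)

end

section \<open>Product measure and exponential moments of path weights\<close>

locale fpp = cayley_graph +
  fixes \<rho> :: "real measure"
  assumes prob: "prob_space \<rho>"
    and sets_\<rho>: "sets \<rho> = sets (restrict_space borel {0..})"
begin

abbreviation "E \<equiv> cayley_edges G S"
abbreviation "P \<equiv> fpp_measure G S \<rho>"

lemma space_\<rho>: "space \<rho> = {0..}"
  using sets_eq_imp_space_eq [OF sets_\<rho>] by (simp add: space_restrict_space)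

lemma measurable_\<rho>: "f \<in> borel_measurable borel \<Longrightarrow> f \<in> borel_measurable \<rho>"
  unfolding measurable_cong_sets [OF sets_\<rho> refl] by (rule measurable_restrict_space1)

lemma P_eq: "P = PiM E (\<lambda>_. \<rho>)"
  by (simp add: fpp_measure_def)

lemma prob_space_P: "prob_space P"
  unfolding P_eq by (intro prob_space_PiM prob)

lemma weight_nonneg: "\<omega> \<in> space P \<Longrightarrow> e \<in> E \<Longrightarrow> 0 \<le> \<omega> e"
  by (auto simp: P_eq space_PiM PiE_iff space_\<rho>)

lemma measurable_path_weight:
  assumes "edge_path G S x y p"
  shows "(\<lambda>\<omega>. path_weight \<omega> p) \<in> borel_measurable P"
  unfolding path_weight_def
proof (rule borel_measurable_sum)
  fix i assume "i \<in> {..<length p - 1}"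
  then have e: "{p ! i, p ! Suc i} \<in> E"
    using assms by (auto simp: edge_path_def)
  have "(\<lambda>\<omega>. \<omega> {p ! i, p ! Suc i}) \<in> measurable P \<rho>"
    unfolding P_eq by (rule measurable_component_singleton [OF e])
  moreover have "(\<lambda>x. x) \<in> borel_measurable \<rho>"
    by (rule measurable_\<rho>) simp
  ultimately show "(\<lambda>\<omega>. \<omega> {p ! i, p ! Suc i}) \<in> borel_measurable P"
    by (rule measurable_compose)
qed

text \<open>The edges of a simple path are distinct, so the exponential factorises over independent
  coordinates. The integral depends only on the finite marginal over
  \<open>path_edges p\<close>.\<close>

lemma nn_integral_exp_path_weight:
  assumes p: "edge_path G S x y p" "distinct p"
  shows "(\<integral>\<^sup>+ \<omega>. ennreal (exp (t * path_weight \<omega> p)) \<partial>P)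
    = (\<integral>\<^sup>+ x. ennreal (exp (t * x)) \<partial>\<rho>) ^ (length p - 1)"
proof -
  interpret product_prob_space "\<lambda>_. \<rho>" E
    by (intro product_prob_spaceI prob)
  let ?J = "path_edges p" and ?g = "\<lambda>x::real. ennreal (exp (t * x))"
  have J: "finite ?J" "?J \<subseteq> E"
    using path_edges_subset [OF p(1)] by (auto simp: path_edges_def)
  have g: "?g \<in> borel_measurable \<rho>"
    by (rule measurable_\<rho>) measurable
  have restr: "(\<lambda>\<omega>. restrict \<omega> ?J) \<in> measurable P (PiM ?J (\<lambda>_. \<rho>))"
    unfolding P_eq by (rule measurable_restrict_subset [OF J(2)])
  have prod: "(\<lambda>\<omega>. \<Prod>e\<in>?J. ?g (\<omega> e)) \<in> borel_measurable (PiM ?J (\<lambda>_. \<rho>))"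
  proof (rule borel_measurable_prod_ennreal)
    fix e assume e: "e \<in> ?J"
    show "(\<lambda>\<omega>. ?g (\<omega> e)) \<in> borel_measurable (PiM ?J (\<lambda>_. \<rho>))"
      by (rule measurable_compose [OF measurable_component_singleton [OF e, where M = "\<lambda>_. \<rho>"] g])
  qed
  have "(\<integral>\<^sup>+ \<omega>. ennreal (exp (t * path_weight \<omega> p)) \<partial>P)
      = (\<integral>\<^sup>+ \<omega>. (\<Prod>e\<in>?J. ?g (restrict \<omega> ?J e)) \<partial>P)"
    using J(1) by (intro nn_integral_cong)
      (simp add: path_weight_eq_sum [OF p(2)] sum_distrib_left exp_sum prod_ennreal)
  also have "\<dots> = (\<integral>\<^sup>+ \<omega>. (\<Prod>e\<in>?J. ?g (\<omega> e)) \<partial>distr P (PiM ?J (\<lambda>_. \<rho>)) (\<lambda>\<omega>. restrict \<omega> ?J))"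
    using prod by (subst nn_integral_distr [OF restr]) simp_all
  also have "\<dots> = (\<integral>\<^sup>+ \<omega>. (\<Prod>e\<in>?J. ?g (\<omega> e)) \<partial>PiM ?J (\<lambda>_. \<rho>))"
    unfolding P_eq distr_PiM_restrict_finite [OF J] ..
  also have "\<dots> = (\<Prod>e\<in>?J. \<integral>\<^sup>+ x. ?g x \<partial>\<rho>)"
    using J(1) g by (intro product_nn_integral_prod)
  finally show ?thesis
    by (simp add: card_path_edges [OF p(2)])
qed

text \<open>Chernoff bound; \<open>t > 0\<close> bounds the upper tail and \<open>t < 0\<close> the lower one.\<close>

lemma path_weight_tail:
  assumes p: "edge_path G S x y p" "distinct p"
  shows "emeasure P {\<omega> \<in> space P. t * a \<le> t * path_weight \<omega> p}
    \<le> ennreal (exp (- (t * a))) * (\<integral>\<^sup>+ x. ennreal (exp (t * x)) \<partial>\<rho>) ^ (length p - 1)"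
proof -
  have [measurable]: "(\<lambda>\<omega>. path_weight \<omega> p) \<in> borel_measurable P"
    by (rule measurable_path_weight [OF p(1)])
  \<comment> \<open>Exponentiating gives the form required by Markov's inequality, for either sign
    of \<open>t\<close>.\<close>
  have "{\<omega> \<in> space P. t * a \<le> t * path_weight \<omega> p}
      = {\<omega> \<in> space P. 1 \<le> ennreal (exp (- (t * a))) * ennreal (exp (t * path_weight \<omega> p))}"
    by (auto simp: ennreal_mult [symmetric] exp_add [symmetric] ennreal_1 [symmetric]
        simp del: ennreal_1)
  also have "emeasure P \<dots> \<le> ennreal (exp (- (t * a)))
      * (\<integral>\<^sup>+ \<omega>. ennreal (exp (t * path_weight \<omega> p)) * indicator (space P) \<omega> \<partial>P)"
    by (rule nn_integral_Markov_inequality) simp_all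
  also have "(\<integral>\<^sup>+ \<omega>. ennreal (exp (t * path_weight \<omega> p)) * indicator (space P) \<omega> \<partial>P)
      = (\<integral>\<^sup>+ x. ennreal (exp (t * x)) \<partial>\<rho>) ^ (length p - 1)"
    unfolding nn_integral_exp_path_weight [OF p, symmetric] by (intro nn_integral_cong) simp
  finally show ?thesis .
qed

text \<open>Union bound over at most \<open>card S ^ n\<close> paths: the assumption makes the
  number of choices times the Chernoff factor at most \<open>1 / 2\<close> per step, so
  Borel-Cantelli applies. Keeping \<open>t\<close> on both sides gives upper and lower bounds from
  one statement.\<close>

lemma AE_linear_bound:
  assumes "ennreal (exp (- (t * a)) * real (card S)) * (\<integral>\<^sup>+ x. ennreal (exp (t * x)) \<partial>\<rho>) \<le> ennreal (1 / 2)"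
  shows "AE \<omega> in P. \<exists>N. \<forall>n\<ge>N. \<forall>p\<in>paths_from_one n. distinct p \<longrightarrow>
    t * path_weight \<omega> p < t * (a * real n)"
proof -
  interpret P: prob_space P by (rule prob_space_P)
  define Q where "Q n = {p \<in> paths_from_one n. distinct p}" for n
  define A where "A n = (\<Union>p\<in>Q n. {\<omega> \<in> space P. t * (a * real n) \<le> t * path_weight \<omega> p})" for n
  let ?I = "\<integral>\<^sup>+ x. ennreal (exp (t * x)) \<partial>\<rho>"
  have fin: "finite (Q n)" and card: "card (Q n) \<le> card S ^ n" for n
    using finite_card_paths_from_one [of n] card_mono [of "paths_from_one n" "Q n"]
    by (auto simp: Q_def intro: order_trans)
  have meas: "{\<omega> \<in> space P. t * (a * real n) \<le> t * path_weight \<omega> p} \<in> sets P" if "p \<in> Q n" for n p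
  proof -
    have [measurable]: "(\<lambda>\<omega>. path_weight \<omega> p) \<in> borel_measurable P"
      using that measurable_path_weight by (auto simp: Q_def paths_from_one_def)
    show ?thesis by measurable
  qed
  have A_sets: "A n \<in> sets P" for n
    unfolding A_def using fin meas by (intro sets.finite_UN) auto
  have A_le: "emeasure P (A n) \<le> ennreal ((1 / 2) ^ n)" for n
  proof -
    have "emeasure P (A n) \<le> (\<Sum>p\<in>Q n. emeasure P {\<omega> \<in> space P. t * (a * real n) \<le> t * path_weight \<omega> p})"
      unfolding A_def using fin meas by (intro emeasure_subadditive_finite) auto
    also have "\<dots> \<le> (\<Sum>p\<in>Q n. ennreal (exp (- (t * a))) ^ n * ?I ^ n)"
    proof (rule sum_mono)
      fix p assume "p \<in> Q n"
      then obtain y where "edge_path G S \<one> y p" "distinct p" "length p - 1 = n"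
        by (auto simp: Q_def paths_from_one_def)
      then have "emeasure P {\<omega> \<in> space P. t * (a * real n) \<le> t * path_weight \<omega> p}
          \<le> ennreal (exp (- (t * (a * real n)))) * ?I ^ n"
        using path_weight_tail [of \<one> y p t "a * real n"] by simp
      moreover have "exp (- (t * (a * real n))) = exp (- (t * a)) ^ n"
        by (simp add: exp_of_nat_mult [symmetric] algebra_simps)
      ultimately show "emeasure P {\<omega> \<in> space P. t * (a * real n) \<le> t * path_weight \<omega> p}
          \<le> ennreal (exp (- (t * a))) ^ n * ?I ^ n"
        by (simp add: ennreal_power)
    qed
    also have "\<dots> = of_nat (card (Q n)) * (ennreal (exp (- (t * a))) * ?I) ^ n"
      by (simp add: power_mult_distrib)
    also have "\<dots> \<le> of_nat (card S ^ n) * (ennreal (exp (- (t * a))) * ?I) ^ n"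
      using card [of n] by (intro mult_right_mono of_nat_mono) auto
    also have "\<dots> = (of_nat (card S) * (ennreal (exp (- (t * a))) * ?I)) ^ n"
      by (simp add: power_mult_distrib)
    also have "of_nat (card S) * (ennreal (exp (- (t * a))) * ?I)
        = ennreal (exp (- (t * a)) * real (card S)) * ?I"
      by (simp add: ennreal_mult ennreal_of_nat_eq_real_of_nat mult_ac)
    also have "\<dots> ^ n \<le> ennreal (1 / 2) ^ n"
      using assms by (intro power_mono) auto
    also have "\<dots> = ennreal ((1 / 2) ^ n)"
      by (rule ennreal_power) simp
    finally show ?thesis .
  qed
  have "summable (\<lambda>n. measure P (A n))"
  proof (rule summable_comparison_test')
    show "summable (\<lambda>n. (1 / 2 :: real) ^ n)"
      by (rule summable_geometric) simp
    show "norm (measure P (A n)) \<le> (1 / 2) ^ n" for n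
      using A_le [of n] by (simp add: P.emeasure_eq_measure)
  qed
  then have "AE \<omega> in P. \<forall>\<^sub>F n in sequentially. \<omega> \<in> space P - A n"
    using A_sets by (intro borel_cantelli_AE1) (auto simp: P.emeasure_eq_measure)
  then show ?thesis
  proof eventually_elim
    case (elim \<omega>)
    then obtain N where N: "\<forall>n\<ge>N. \<omega> \<in> space P - A n"
      unfolding eventually_sequentially by blast
    show ?case
    proof (intro exI [of _ N] allI impI ballI)
      fix n p assume "N \<le> n" "p \<in> paths_from_one n" "distinct p"
      then show "t * path_weight \<omega> p < t * (a * real n)"
        using N unfolding A_def Q_def by (metis (mono_tags, lifting) DiffE UN_I mem_Collect_eq not_le)
    qed
  qed
qed

text \<open>Without an atom at \<open>0\<close> the Laplace transform of \<open>\<rho>\<close> vanishes at infinity, which beats the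
  exponential number of paths.\<close>

lemma laplace_transform_tendsto_0:
  assumes "emeasure \<rho> {0} = 0"
  shows "(\<lambda>n. \<integral>\<^sup>+ x. ennreal (exp (- (real n * x))) \<partial>\<rho>) \<longlonglongrightarrow> 0"
proof -
  interpret \<rho>: prob_space \<rho> by (rule prob)
  have "{0} \<in> sets \<rho>"
    unfolding sets_\<rho> by (simp add: sets_restrict_space_iff)
  with assms have "AE x in \<rho>. x \<noteq> 0"
    by (intro AE_I [of _ _ "{0}"]) auto
  then have pos: "AE x in \<rho>. 0 < x"
    using AE_space by eventually_elim (auto simp: space_\<rho>)
  have "(\<lambda>n. \<integral>\<^sup>+ x. ennreal (exp (- (real n * x))) \<partial>\<rho>) \<longlonglongrightarrow> (\<integral>\<^sup>+ x. 0 \<partial>\<rho>)"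
  proof (rule nn_integral_dominated_convergence [where w = "\<lambda>_. 1"])
    show "(\<lambda>x. ennreal (exp (- (real n * x)))) \<in> borel_measurable \<rho>" for n
      by (rule measurable_\<rho>) measurable
    show "AE x in \<rho>. ennreal (exp (- (real n * x))) \<le> 1" for n
      using pos by eventually_elim (simp add: ennreal_1 [symmetric] del: ennreal_1)
    show "AE x in \<rho>. (\<lambda>n. ennreal (exp (- (real n * x)))) \<longlonglongrightarrow> 0"
      using pos
    proof eventually_elim
      case (elim x)
      have "(\<lambda>n. exp (- (real n * x))) \<longlonglongrightarrow> 0"
        using elim by real_asymp
      then show ?case
        by (simp add: tendsto_ennreal_iff [symmetric, of "\<lambda>n. exp (- (real n * x))" _ 0] del: tendsto_ennreal_iff)
    qed
  qed (simp_all add: \<rho>.emeasure_space_1)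
  then show ?thesis by simp
qed

text \<open>Above, the exponent \<open>a\<close> is fixed and the slope \<open>C\<close> is large,
  so \<open>exp (- (a * C))\<close> beats the path count. Below, the slope is \<open>1 / t\<close>:
  the prefactor stays \<open>exp 1\<close> while the Laplace transform at a large \<open>t\<close>
  is small.\<close>

lemma AE_linear_passage_times:
  assumes "emeasure \<rho> {0} = 0" and "0 < a" and "(\<integral>\<^sup>+ x. ennreal (exp (a * x)) \<partial>\<rho>) < \<infinity>"
  shows "AE \<omega> in P. linear_passage_times \<omega>"
proof -
  let ?D = "real (card S)"
  obtain b where b: "0 \<le> b" "(\<integral>\<^sup>+ x. ennreal (exp (a * x)) \<partial>\<rho>) = ennreal b"
    using assms(3) by (metis ennreal_cases infinity_ennreal_def less_irrefl)
  have "(\<lambda>n. exp (- (a * real n)) * ?D * b) \<longlonglongrightarrow> 0"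
    using assms(2) by real_asymp
  then have "\<forall>\<^sub>F n in sequentially. exp (- (a * real n)) * ?D * b < 1 / 2"
    by (rule order_tendstoD) simp
  then obtain C :: nat where C: "exp (- (a * real C)) * ?D * b < 1 / 2"
    unfolding eventually_sequentially by blast
  have "ennreal (exp (- (a * real C)) * ?D) * ennreal b = ennreal (exp (- (a * real C)) * ?D * b)"
    using b(1) by (simp add: ennreal_mult)
  also have "\<dots> \<le> ennreal (1 / 2)"
    using C by (intro ennreal_leI) simp
  finally have upper: "AE \<omega> in P. \<exists>N. \<forall>n\<ge>N. \<forall>p\<in>paths_from_one n. distinct p \<longrightarrow>
      a * path_weight \<omega> p < a * (real C * real n)"
    unfolding b(2) [symmetric] by (rule AE_linear_bound)
  \<comment> \<open>The \<open>6\<close> combines \<open>exp 1 \<le> 3\<close> with the target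
    \<open>1 / 2\<close>; the \<open>+ 1\<close> keeps the denominator positive for empty
    \<open>S\<close>.\<close>
  have "(0::ennreal) < ennreal (1 / (6 * (?D + 1)))"
    by simp
  then have "\<forall>\<^sub>F n in sequentially.
      (\<integral>\<^sup>+ x. ennreal (exp (- (real n * x))) \<partial>\<rho>) < ennreal (1 / (6 * (?D + 1)))"
    using laplace_transform_tendsto_0 [OF assms(1)] by (rule order_tendstoD(2) [rotated])
  then obtain N where N: "\<And>n. n \<ge> N \<Longrightarrow>
      (\<integral>\<^sup>+ x. ennreal (exp (- (real n * x))) \<partial>\<rho>) < ennreal (1 / (6 * (?D + 1)))"
    unfolding eventually_sequentially by blast
  \<comment> \<open>The successor ensures \<open>0 < t\<close>.\<close>
  define t where "t = real (Suc N)"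
  have t: "0 < t" "(\<integral>\<^sup>+ x. ennreal (exp (- t * x)) \<partial>\<rho>) \<le> ennreal (1 / (6 * (?D + 1)))"
  proof -
    show "0 < t" by (simp add: t_def)
    show "(\<integral>\<^sup>+ x. ennreal (exp (- t * x)) \<partial>\<rho>) \<le> ennreal (1 / (6 * (?D + 1)))"
      unfolding t_def mult_minus_left by (rule less_imp_le, rule N) simp
  qed
  have "exp 1 * ?D * (1 / (6 * (?D + 1))) \<le> 1 / 2"
  proof -
    have "exp 1 * ?D \<le> 3 * (?D + 1)"
      using exp_le by (intro mult_mono) auto
    then show ?thesis
      by (simp add: divide_le_eq)
  qed
  have "ennreal (exp (- (- t * (1 / t))) * ?D) * (\<integral>\<^sup>+ x. ennreal (exp (- t * x)) \<partial>\<rho>)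
      \<le> ennreal (exp 1 * ?D) * ennreal (1 / (6 * (?D + 1)))"
    using t by (intro mult_mono) auto
  also have "\<dots> = ennreal (exp 1 * ?D * (1 / (6 * (?D + 1))))"
    by (rule ennreal_mult [symmetric]) simp_all
  also have "\<dots> \<le> ennreal (1 / 2)"
    by (rule ennreal_leI) fact
  finally have lower: "AE \<omega> in P. \<exists>N. \<forall>n\<ge>N. \<forall>p\<in>paths_from_one n. distinct p \<longrightarrow>
      - t * path_weight \<omega> p < - t * (1 / t * real n)"
    by (rule AE_linear_bound)
  from upper lower AE_space show ?thesis
  proof eventually_elim
    case (elim \<omega>)
    obtain N1 where N1: "\<forall>n\<ge>N1. \<forall>p\<in>paths_from_one n. distinct p \<longrightarrow>
        a * path_weight \<omega> p < a * (real C * real n)"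
      using elim(1) by blast
    obtain N2 where N2: "\<forall>n\<ge>N2. \<forall>p\<in>paths_from_one n. distinct p \<longrightarrow>
        - t * path_weight \<omega> p < - t * (1 / t * real n)"
      using elim(2) by blast
    have lin: "1 / t * real n \<le> path_weight \<omega> p \<and> path_weight \<omega> p \<le> real C * real n"
      if "n \<ge> max N1 N2" "p \<in> paths_from_one n" "distinct p" for n p
    proof
      have "- t * path_weight \<omega> p < - t * (1 / t * real n)"
        using that N2 by simp
      then show "1 / t * real n \<le> path_weight \<omega> p"
        using t(1) by (simp add: divide_le_eq mult.commute)
      have "a * path_weight \<omega> p < a * (real C * real n)"
        using that N1 by simp
      then show "path_weight \<omega> p \<le> real C * real n"
        using assms(2) by simp
    qed
    have lin_ex: "\<exists>C N. \<forall>n\<ge>N. \<forall>p\<in>paths_from_one n. distinct p \<longrightarrow>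
        1 / t * real n \<le> path_weight \<omega> p \<and> path_weight \<omega> p \<le> C * real n"
      by (rule exI [of _ "real C"], rule exI [of _ "max N1 N2"], intro allI ballI impI, rule lin)
    show ?case
      unfolding linear_passage_times_def
    proof (rule conjI)
      show "\<forall>e\<in>E. 0 \<le> \<omega> e"
        using weight_nonneg [OF elim(3)] by simp
      show "\<exists>c>0. \<exists>C N. \<forall>n\<ge>N. \<forall>p\<in>paths_from_one n. distinct p \<longrightarrow>
          c * real n \<le> path_weight \<omega> p \<and> path_weight \<omega> p \<le> C * real n"
        by (rule exI [of _ "1 / t"], rule conjI [OF _ lin_ex]) (use t(1) in simp)
    qed
  qed
qed

end

theorem theorem1p10:
  fixes G :: "('a, 'b) monoid_scheme" and S :: "'a set" and \<rho> :: "real measure"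
  assumes "group G"
    and "finite S" and "S \<subseteq> carrier G" and "\<forall>s\<in>S. inv\<^bsub>G\<^esub> s \<in> S" and "generate G S = carrier G"
    and "gromov_hyperbolic G S" and "\<not> elementary_group G"
    and "prob_space \<rho>" and "sets \<rho> = sets (restrict_space borel {0..})"
    and "\<forall>x\<in>{0..}. emeasure \<rho> {x} = 0"
    and "\<exists>a>0. (\<integral>\<^sup>+ x. ennreal (exp (a * x)) \<partial>\<rho>) < \<infinity>"
  shows "\<exists>\<Omega>\<^sub>0 \<in> sets (fpp_measure G S \<rho>). emeasure (fpp_measure G S \<rho>) \<Omega>\<^sub>0 = 1 \<and>
           (\<forall>\<omega>\<in>\<Omega>\<^sub>0. \<forall>\<xi>\<in>gromov_boundary G S.
              \<exists>\<sigma>. \<sigma> 0 = \<one>\<^bsub>G\<^esub> \<and> fpp_geodesic_ray G S \<omega> \<sigma> \<and> has_direction G S \<sigma> \<xi>)"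
proof -
  interpret fpp G S \<rho>
  proof (intro fpp.intro cayley_graph.intro cayley_graph_axioms.intro fpp_axioms.intro)
    show "inv\<^bsub>G\<^esub> s \<in> S" if "s \<in> S" for s
      using assms(4) that by (rule bspec)
  qed fact+
  obtain \<delta> where \<delta>: "\<forall>w\<in>carrier G. \<forall>x\<in>carrier G. \<forall>y\<in>carrier G. \<forall>z\<in>carrier G.
      gromov_product G S w x z \<ge> min (gromov_product G S w x y) (gromov_product G S w y z) - \<delta>"
    using assms(6) unfolding gromov_hyperbolic_def by blast
  \<comment> \<open>The constant given by hyperbolicity may be negative, hence
    \<open>max \<delta> 0\<close>.\<close>
  interpret hyperbolic_cayley_graph G S "max \<delta> 0"
  proof unfold_locales
    fix x y z assume "x \<in> carrier G" "y \<in> carrier G" "z \<in> carrier G"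
    then have "min (gp x y) (gp y z) - \<delta> \<le> gp x z"
      using \<delta> one_closed by simp
    then show "min (gp x y) (gp y z) \<le> gp x z + max \<delta> 0"
      by linarith
  qed simp
  obtain a where "0 < a" "(\<integral>\<^sup>+ x. ennreal (exp (a * x)) \<partial>\<rho>) < \<infinity>"
    using assms(11) by blast
  then have "AE \<omega> in P. linear_passage_times \<omega>"
    using assms(10) by (intro AE_linear_passage_times) auto
  \<comment> \<open>Removing a measurable null set that contains all bad \<open>\<omega>\<close>
    gives a measurable \<open>\<Omega>\<^sub>0\<close>. It serves all \<open>\<xi>\<close> at once,
    because \<open>linear_passage_times\<close> does not depend on \<open>\<xi>\<close>.\<close>
  then obtain N where N: "{\<omega> \<in> space P. \<not> linear_passage_times \<omega>} \<subseteq> N"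
      "emeasure P N = 0" "N \<in> sets P"
    by (rule AE_E)
  show ?thesis
  proof (rule bexI [of _ "space P - N"], rule conjI)
    have "emeasure P (space P - N) = emeasure P (space P)"
      using N(2,3) by (intro emeasure_Diff_null_set null_setsI) auto
    also have "\<dots> = 1"
      by (rule prob_space.emeasure_space_1 [OF prob_space_P])
    finally show "emeasure P (space P - N) = 1" .
    show "\<forall>\<omega>\<in>space P - N. \<forall>\<xi>\<in>gromov_boundary G S.
        \<exists>\<sigma>. \<sigma> 0 = \<one>\<^bsub>G\<^esub> \<and> fpp_geodesic_ray G S \<omega> \<sigma> \<and> has_direction G S \<sigma> \<xi>"
    proof (intro ballI)
      fix \<omega> \<xi> assume \<omega>: "\<omega> \<in> space P - N" and \<xi>: "\<xi> \<in> gromov_boundary G S"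
      have "linear_passage_times \<omega>"
        using \<omega> N(1) by blast
      then show "\<exists>\<sigma>. \<sigma> 0 = \<one>\<^bsub>G\<^esub> \<and> fpp_geodesic_ray G S \<omega> \<sigma> \<and> has_direction G S \<sigma> \<xi>"
        using \<xi> by (rule geodesic_ray_exists)
    qed
    show "space P - N \<in> sets P"
      using N(3) by auto
  qed
qed

end
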